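(* Let $n\ge 2$. There exist constants $c,c_0>0$, independent of $\kappa$, $t$ and $\omega$, such that the following holds for every $\kappa\ge 1$. If $\omega:\mathbb{R}_+\to\mathbb{R}_+$ is a non-decreasing function such that $$\|f\|_{L^2(\mathbb{S}^{n-1})}\le\omega\left(\|A_\kappa f\|_{L^2(B_1)}\right)\quad\text{whenever } \|f\|_{H^1(\mathbb{S}^{n-1})}\le 1,$$ then $$\omega(t)\ge c\,\max\left\{t,\ \kappa^{-1}(1+\log(1/t))^{-1}\right\}\quad\text{for all } 0<t\le c_0.$$
   Context: $\mathbb{R}_+=[0,\infty)$; $B_1$ is the open unit ball in $\mathbb{R}^n$; $\mathrm{d}S$ is the surface measure on $\mathbb{S}^{n-1}$. For $f\in L^2(\mathbb{S}^{n-1})$ and $\kappa>0$, $(P_\kappa f)(x)=\int_{\mathbb{S}^{n-1}}e^{\mathbf{i}\kappa\omega\cdot x}f(\omega)\,\mathrm{d}S(\omega)$ for $x\in\mathbb{R}^n$, and $A_\kappa:L^2(\mathbb{S}^{n-1})\to L^2(B_1)$ is defined by $A_\kappa f=\kappa^{\frac{n-1}{2}}(P_\kappa f)|_{B_1}$. Let $(\phi_\ell)_{\ell\ge1}$ be an orthonormal basis of $L^2(\mathbb{S}^{n-1})$ of eigenfunctions of the Laplace-Beltrami operator, $-\Delta_{\mathbb{S}^{n-1}}\phi_\ell=\lambda_\ell\phi_\ell$ with $0=\lambda_1<\lambda_2\le\lambda_3\le\cdots$. The Sobolev space $H^s(\mathbb{S}^{n-1})$ is equipped with the norm $\|f\|_{H^s(\mathbb{S}^{n-1})}=\left(\sum_{\ell=1}^\infty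 \ell^{\frac{2s}{n-1}}|(f,\phi_\ell)|^2\right)^{1/2}$, where $(\cdot,\cdot)$ is the $L^2(\mathbb{S}^{n-1})$ inner product (by Weyl asymptotics this is equivalent to the usual norm). *)

theory Defs
  imports "HOL-Analysis.Analysis"
begin

text \<open>
  The ambient space is \<open>real ^ 'n\<close> with \<open>n = CARD('n)\<close>. Functions on the unit sphere are
  represented by functions on the whole space of which only the values on \<open>sphere 0 1\<close> matter.
\<close>

subsection \<open>Surface measure\<close>

text \<open>
  By polar coordinates, the surface measure of a Borel set \<open>E\<close> in the sphere is \<open>n\<close> times the
  volume of the cone \<open>{r p | 0 < r < 1, p \<in> E}\<close>. For \<open>x \<noteq> 0\<close>, \<open>sgn x = x /\<^sub>R norm x\<close>.
\<close>

definition sphere_measure :: "(real ^ 'n) measure" where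
  "sphere_measure = scale_measure (of_nat CARD('n))
     (distr (restrict_space lborel (ball 0 1 - {0})) (restrict_space borel (sphere 0 1)) sgn)"

lemma space_sphere_measure [simp]: "space (sphere_measure :: (real ^ 'n) measure) = sphere 0 1"
  by (simp add: sphere_measure_def space_scale_measure space_restrict_space)

lemma sets_sphere_measure [simp, measurable_cong]:
  "sets (sphere_measure :: (real ^ 'n) measure) = sets (restrict_space borel (sphere 0 1))"
  by (simp add: sphere_measure_def)

lemma emeasure_sphere_measure:
  fixes E :: "(real ^ 'n) set"
  assumes "E \<in> sets borel" "E \<subseteq> sphere 0 1"
  shows "emeasure sphere_measure E =
    of_nat CARD('n) * emeasure lborel {r *\<^sub>R p | r p. 0 < r \<and> r < 1 \<and> p \<in> E}"
proof -
  let ?M = "restrict_space lborel (ball 0 1 - {0}) :: (real ^ 'n) measure"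
  have E: "E \<in> sets (restrict_space borel (sphere 0 1))"
    using assms by (simp add: sets_restrict_space_iff)
  have "sgn \<in> borel_measurable ?M"
    by (auto simp: sgn_div_norm measurable_restrict_space1)
  then have meas: "sgn \<in> measurable ?M (restrict_space borel (sphere 0 1))"
    by (intro measurable_restrict_space2) (auto simp: space_restrict_space norm_sgn)
  have "sgn -` E \<inter> space ?M = {r *\<^sub>R p | r p. 0 < r \<and> r < 1 \<and> p \<in> E}"
  proof (intro equalityI subsetI)
    fix x assume x: "x \<in> sgn -` E \<inter> space ?M"
    then have "x = norm x *\<^sub>R sgn x" "0 < norm x" "norm x < 1" "sgn x \<in> E"
      by (auto simp: space_restrict_space sgn_div_norm)
    then show "x \<in> {r *\<^sub>R p | r p. 0 < r \<and> r < 1 \<and> p \<in> E}"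
      by blast
  next
    fix x assume "x \<in> {r *\<^sub>R p | r p. 0 < r \<and> r < 1 \<and> p \<in> E}"
    then obtain r p where "x = r *\<^sub>R p" "0 < r" "r < 1" "p \<in> E"
      by blast
    moreover from this have "norm p = 1"
      using assms(2) by auto
    ultimately show "x \<in> sgn -` E \<inter> space ?M"
      by (auto simp: space_restrict_space sgn_div_norm)
  qed
  moreover have "emeasure ?M (sgn -` E \<inter> space ?M) = emeasure lborel (sgn -` E \<inter> space ?M)"
    by (intro emeasure_restrict_space) (auto simp: space_restrict_space)
  ultimately show ?thesis
    by (simp add: sphere_measure_def emeasure_distr[OF meas E])
qed


subsection \<open>Square-integrable functions\<close>

definition L2 :: "'a measure \<Rightarrow> ('a \<Rightarrow> complex) set" where
  "L2 M = {f \<in> borel_measurable M. integrable M (\<lambda>x. (cmod (f x))\<^sup>2)}"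

definition L2_norm :: "'a measure \<Rightarrow> ('a \<Rightarrow> complex) \<Rightarrow> real" where
  "L2_norm M f = sqrt (\<integral>x. (cmod (f x))\<^sup>2 \<partial>M)"

definition L2_inner :: "'a measure \<Rightarrow> ('a \<Rightarrow> complex) \<Rightarrow> ('a \<Rightarrow> complex) \<Rightarrow> complex" where
  "L2_inner M f g = (\<integral>x. f x * cnj (g x) \<partial>M)"

text \<open>The sequences are indexed from 1; the value at index 0 is irrelevant.\<close>

definition orthonormal_basis_L2 :: "'a measure \<Rightarrow> (nat \<Rightarrow> 'a \<Rightarrow> complex) \<Rightarrow> bool" where
  "orthonormal_basis_L2 M \<phi> \<longleftrightarrow>
     (\<forall>l\<ge>1. \<phi> l \<in> L2 M) \<and>
     (\<forall>k\<ge>1. \<forall>l\<ge>1. L2_inner M (\<phi> k) (\<phi> l) = (if k = l then 1 else 0)) \<and>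
     (\<forall>f\<in>L2 M. (\<lambda>N. L2_norm M (\<lambda>x. f x - (\<Sum>l=1..N. L2_inner M f (\<phi> l) * \<phi> l x)))
        \<longlonglongrightarrow> 0)"


subsection \<open>Laplace-Beltrami operator\<close>

text \<open>
  Composing with \<open>sgn\<close> extends a function on the sphere constantly along rays. The Euclidean
  derivative of the extension at a point of the sphere vanishes in the normal direction and agrees
  with the intrinsic derivative in tangential directions. Hence the Euclidean gradient of the
  extension is the Riemannian gradient, and for a tangential field the trace of the derivative of
  the extension is the Riemannian divergence.
\<close>

definition sphere_grad :: "(real ^ 'n \<Rightarrow> complex) \<Rightarrow> real ^ 'n \<Rightarrow> complex ^ 'n" where
  "sphere_grad f p = (\<chi> i. frechet_derivative (f \<circ> sgn) (at p) (axis i 1))"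

definition sphere_div :: "(real ^ 'n \<Rightarrow> complex ^ 'n) \<Rightarrow> real ^ 'n \<Rightarrow> complex" where
  "sphere_div X p = (\<Sum>i\<in>UNIV. frechet_derivative ((\<lambda>q. X q $ i) \<circ> sgn) (at p) (axis i 1))"

definition laplace_beltrami :: "(real ^ 'n \<Rightarrow> complex) \<Rightarrow> real ^ 'n \<Rightarrow> complex" where
  "laplace_beltrami f = sphere_div (sphere_grad f)"

primrec Ck_sphere :: "nat \<Rightarrow> (real ^ 'n \<Rightarrow> complex) \<Rightarrow> bool" where
  "Ck_sphere 0 f \<longleftrightarrow> continuous_on (sphere 0 1) f"
| "Ck_sphere (Suc k) f \<longleftrightarrow>
     (\<forall>p\<in>sphere 0 1. (f \<circ> sgn) differentiable (at p)) \<and>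
     (\<forall>i. Ck_sphere k (\<lambda>p. sphere_grad f p $ i))"

text \<open>
  By elliptic regularity every eigenfunction in \<open>L\<^sup>2\<close> has a smooth representative, so
  eigenfunctions may be taken in the classical sense.
\<close>

definition laplace_eigenbasis :: "(nat \<Rightarrow> real ^ 'n \<Rightarrow> complex) \<Rightarrow> (nat \<Rightarrow> real) \<Rightarrow> bool" where
  "laplace_eigenbasis \<phi> \<mu> \<longleftrightarrow>
     orthonormal_basis_L2 sphere_measure \<phi> \<and>
     (\<forall>l\<ge>1. Ck_sphere 2 (\<phi> l) \<and>
        (\<forall>p\<in>sphere 0 1. - laplace_beltrami (\<phi> l) p = of_real (\<mu> l) * \<phi> l p)) \<and>
     \<mu> 1 = 0 \<and> 0 < \<mu> 2 \<and> (\<forall>l\<ge>2. \<mu> l \<le> \<mu> (Suc l))"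


subsection \<open>Sobolev spaces of order \<open>s \<ge> 0\<close> on the sphere\<close>

definition sobolev_sphere ::
    "(nat \<Rightarrow> real ^ 'n \<Rightarrow> complex) \<Rightarrow> real \<Rightarrow> (real ^ 'n \<Rightarrow> complex) set" where
  "sobolev_sphere \<phi> s = {f \<in> L2 sphere_measure.
     (\<lambda>l. real l powr (2 * s / (real CARD('n) - 1)) * (cmod (L2_inner sphere_measure f (\<phi> l)))\<^sup>2)
       summable_on {1..}}"

definition sobolev_norm ::
    "(nat \<Rightarrow> real ^ 'n \<Rightarrow> complex) \<Rightarrow> real \<Rightarrow> (real ^ 'n \<Rightarrow> complex) \<Rightarrow> real" where
  "sobolev_norm \<phi> s f = sqrt (\<Sum>\<^sub>\<infinity>l\<in>{1..}.
     real l powr (2 * s / (real CARD('n) - 1)) * (cmod (L2_inner sphere_measure f (\<phi> l)))\<^sup>2)"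


subsection \<open>The operators \<open>P\<^sub>\<kappa>\<close> and \<open>A\<^sub>\<kappa>\<close>\<close>

definition herglotz :: "real \<Rightarrow> (real ^ 'n \<Rightarrow> complex) \<Rightarrow> real ^ 'n \<Rightarrow> complex" where
  "herglotz \<kappa> f x = (\<integral>p. exp (\<i> * of_real (\<kappa> * (p \<bullet> x))) * f p \<partial>sphere_measure)"

text \<open>
  The restriction to the unit ball is effected by always measuring \<open>scaled_herglotz \<kappa> f\<close> in
  \<open>L2_norm (lebesgue_on (ball 0 1))\<close>.
\<close>

definition scaled_herglotz :: "real \<Rightarrow> (real ^ 'n \<Rightarrow> complex) \<Rightarrow> real ^ 'n \<Rightarrow> complex" where
  "scaled_herglotz \<kappa> f x = of_real (\<kappa> powr ((real CARD('n) - 1) / 2)) * herglotz \<kappa> f x"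

end

theory Submission
  imports Defs "HOL-Probability.Probability"
begin

text \<open>
  Both lower bounds come from test functions in a finite span of the \<open>\<phi>\<^sub>l\<close>. As the Sobolev norm is weighted
  by the index \<open>l\<close>, it is controlled there by the number of functions spanned.

  The bound \<open>\<omega> t \<ge> c t\<close> uses a multiple of \<open>\<phi>\<^sub>1\<close> and the uniform boundedness of \<open>A\<^sub>\<kappa>\<close>. For the latter the
  indicator of the ball is dominated by a Gaussian; its Fourier transform turns the weighted norm of \<open>P\<^sub>\<kappa> f\<close>
  into a quadratic form on the sphere with kernel \<open>exp (- \<kappa>\<^sup>2 |p - q|\<^sup>2 / 2)\<close>, to which Schur's test applies.

  For the logarithmic bound, polynomials of degree below \<open>m\<close> restricted to the sphere span a space of dimension
  at most \<open>2 m ^ (n - 1)\<close>. Hence some \<open>f \<noteq> 0\<close> in the span of the first \<open>2 m ^ (n - 1) + 1\<close> functions \<open>\<phi>\<^sub>l\<close>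
  is orthogonal to all of them; it satisfies \<open>\<parallel>f\<parallel>\<^bsub>H\<^sup>1\<^esub> \<le> 3 m \<parallel>f\<parallel>\<close>, and by Taylor expansion of the exponential
  \<open>P\<^sub>\<kappa> f\<close> is of size \<open>\<kappa> ^ m / m!\<close>. Take \<open>m\<close> of order \<open>\<kappa> + log (1 / t)\<close>.
\<close>

subsection \<open>Gaussians\<close>

lemma nn_integral_lborel_affine:
  fixes g :: "'a::euclidean_space \<Rightarrow> ennreal"
  assumes [measurable]: "g \<in> borel_measurable borel" and "0 < c"
  shows "(\<integral>\<^sup>+x. g x \<partial>lborel) = ennreal (c ^ DIM('a)) * (\<integral>\<^sup>+x. g (t + c *\<^sub>R x) \<partial>lborel)"
  using assms(2)
  by (subst lborel_affine[of c t])
     (auto simp: nn_integral_density nn_integral_distr nn_integral_cmult)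

definition gaussian_density :: "'a::euclidean_space \<Rightarrow> real" where
  "gaussian_density x = exp (- (norm x)\<^sup>2 / 2) / sqrt (2 * pi) ^ DIM('a)"

lemma borel_measurable_gaussian_density [measurable]: "gaussian_density \<in> borel_measurable borel"
  unfolding gaussian_density_def by simp

lemma gaussian_density_pos: "0 < gaussian_density x"
  by (simp add: gaussian_density_def)

lemma gaussian_density_eq_prod:
  fixes x :: "'a::euclidean_space"
  shows "gaussian_density x = (\<Prod>b\<in>Basis. std_normal_density (x \<bullet> b))"
proof -
  have "(norm x)\<^sup>2 = (\<Sum>b\<in>Basis. (x \<bullet> b)\<^sup>2)"
    by (subst power2_norm_eq_inner, subst euclidean_inner) (simp add: power2_eq_square)
  then show ?thesis
    by (simp add: gaussian_density_def std_normal_density_def prod.distrib exp_sum[symmetric]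
        sum_divide_distrib sum_negf prod_dividef divide_simps)
qed

text \<open>Density and exponential both factor over the coordinates, and each factor integrates to
  the characteristic function of the standard normal distribution. Integrability is recorded along
  with the value because Fubini's theorem later calls for both.\<close>

lemma gaussian_density_fourier:
  fixes \<xi> :: "'a::euclidean_space"
  shows "has_bochner_integral lborel
    (\<lambda>x. complex_of_real (gaussian_density x) * iexp (\<xi> \<bullet> x)) (complex_of_real (exp (- (norm \<xi>)\<^sup>2 / 2)))"
proof -
  interpret product_sigma_finite "\<lambda>_::'a. lborel :: real measure" ..
  define h where "h b y = complex_of_real (std_normal_density y) * iexp ((\<xi> \<bullet> b) * y)" for b y
  have [measurable]: "h b \<in> borel_measurable borel" for b
    unfolding h_def by measurable
  have int: "integrable lborel (h b)" for b
    by (rule Bochner_Integration.integrable_bound[OF integrable_normal_density[of 1 0]])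
       (auto simp: h_def norm_mult)
  have val: "integral\<^sup>L lborel (h b) = exp (- (\<xi> \<bullet> b)\<^sup>2 / 2)" for b
    using fun_cong[OF char_std_normal_distribution, of "\<xi> \<bullet> b"]
    by (simp add: char_def integral_density h_def[abs_def] scaleR_conv_of_real)
  have prod_eq: "complex_of_real (gaussian_density x) * iexp (\<xi> \<bullet> x) = (\<Prod>b\<in>Basis. h b (x \<bullet> b))" for x
  proof -
    have "iexp (\<xi> \<bullet> x) = (\<Prod>b\<in>Basis. iexp ((\<xi> \<bullet> b) * (x \<bullet> b)))"
      by (subst euclidean_inner) (simp add: exp_sum[symmetric] sum_distrib_left)
    then show ?thesis
      by (simp add: gaussian_density_eq_prod h_def prod.distrib)
  qed
  have repr: "(\<Prod>b\<in>Basis. h b ((\<Sum>c\<in>Basis. y c *\<^sub>R c) \<bullet> b)) = (\<Prod>b\<in>Basis. h b (y b))" for y :: "'a \<Rightarrow> real"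
    by (intro prod.cong) auto
  have norm2: "(norm \<xi>)\<^sup>2 = (\<Sum>b\<in>Basis. (\<xi> \<bullet> b)\<^sup>2)"
    by (subst power2_norm_eq_inner, subst euclidean_inner) (simp add: power2_eq_square)
  show ?thesis
    unfolding prod_eq has_bochner_integral_iff
  proof
    show "integrable lborel (\<lambda>x::'a. \<Prod>b\<in>Basis. h b (x \<bullet> b))"
      by (subst lborel_eq, subst integrable_distr_eq)
         (auto simp: repr simp del: inner_sum_left_Basis intro!: product_integrable_prod int)
    have "(\<integral>x. (\<Prod>b\<in>Basis. h b (x \<bullet> b)) \<partial>(lborel::'a measure)) = (\<Prod>b\<in>Basis. integral\<^sup>L lborel (h b))"
      by (subst lborel_eq, subst integral_distr)
         (auto simp: repr simp del: inner_sum_left_Basis intro!: product_integral_prod int)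
    also have "\<dots> = exp (- (norm \<xi>)\<^sup>2 / 2)"
      by (simp add: val norm2 exp_sum[symmetric] sum_divide_distrib sum_negf
          flip: of_real_prod)
    finally show "(\<integral>x. (\<Prod>b\<in>Basis. h b (x \<bullet> b)) \<partial>(lborel::'a measure)) = exp (- (norm \<xi>)\<^sup>2 / 2)" .
  qed
qed

text \<open>The total mass is the Fourier transform at frequency 0.\<close>

lemma nn_integral_gaussian_density: "(\<integral>\<^sup>+x. gaussian_density (x::'a::euclidean_space) \<partial>lborel) = 1"
proof -
  have *: "has_bochner_integral lborel (\<lambda>x::'a. complex_of_real (gaussian_density x)) 1"
    using gaussian_density_fourier[of "0::'a"] by simp
  then have "integrable lborel (gaussian_density :: 'a \<Rightarrow> real)"
    by (simp add: has_bochner_integral_iff complex_of_real_integrable_eq)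
  moreover have "integral\<^sup>L lborel (gaussian_density :: 'a \<Rightarrow> real) = 1"
    using * by (simp add: has_bochner_integral_iff)
  ultimately show ?thesis
    by (subst nn_integral_eq_integral) (auto intro: less_imp_le gaussian_density_pos)
qed

lemma nn_integral_gaussian:
  fixes p :: "'a::euclidean_space"
  assumes "0 < s"
  shows "(\<integral>\<^sup>+x. exp (- (s * norm (x - p))\<^sup>2 / 2) \<partial>lborel) = ennreal ((sqrt (2 * pi) / s) ^ DIM('a))"
proof -
  have "(\<integral>\<^sup>+x. exp (- (s * norm (x - p))\<^sup>2 / 2) \<partial>lborel) =
      ennreal ((1 / s) ^ DIM('a)) * (\<integral>\<^sup>+x. exp (- (norm (x::'a))\<^sup>2 / 2) \<partial>lborel)"
    using assms by (subst nn_integral_lborel_affine[of _ "1 / s" p]) (auto)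
  also have "(\<integral>\<^sup>+x. exp (- (norm (x::'a))\<^sup>2 / 2) \<partial>lborel) =
      (\<integral>\<^sup>+x. ennreal (sqrt (2 * pi) ^ DIM('a)) * gaussian_density (x::'a) \<partial>lborel)"
    by (simp add: gaussian_density_def flip: ennreal_mult)
  also have "\<dots> = ennreal (sqrt (2 * pi) ^ DIM('a))"
    by (simp add: nn_integral_cmult nn_integral_gaussian_density)
  finally show ?thesis
    using assms by (simp add: power_divide flip: ennreal_mult)
qed

subsection \<open>Integration over the sphere\<close>

lemma borel_measurable_sgn_vec [measurable]: "sgn \<in> borel_measurable (borel :: (real^'n) measure)"
  unfolding sgn_div_norm by simp

lemma measurable_sgn_sphere:
  "sgn \<in> measurable (restrict_space lborel (ball 0 1 - {0::real^'n})) (restrict_space borel (sphere 0 1))"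
proof (intro measurable_restrict_space2)
  show "sgn \<in> borel_measurable (restrict_space lborel (ball 0 1 - {0::real^'n}))"
    by (auto simp: sgn_div_norm measurable_restrict_space1)
qed (auto simp: space_restrict_space norm_sgn)

text \<open>The surface measure is a push-forward from the punctured ball; the origin is a null set,
  so the integral may run over the full ball.\<close>

lemma nn_integral_sphere_measure:
  assumes [measurable]: "g \<in> borel_measurable (borel :: (real^'n) measure)"
  shows "(\<integral>\<^sup>+p. g p \<partial>sphere_measure) =
    of_nat CARD('n) * (\<integral>\<^sup>+x. g (sgn x) * indicator (ball 0 1) (x :: real^'n) \<partial>lborel)"
proof -
  have "(\<integral>\<^sup>+p. g p \<partial>sphere_measure) =
      of_nat CARD('n) * (\<integral>\<^sup>+x. g (sgn x) * indicator (ball 0 1 - {0}) (x :: real^'n) \<partial>lborel)"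
    unfolding sphere_measure_def
    by (subst nn_integral_scale_measure)
       (auto simp: nn_integral_distr[OF measurable_sgn_sphere] nn_integral_restrict_space measurable_restrict_space1)
  also have "(\<integral>\<^sup>+x. g (sgn x) * indicator (ball 0 1 - {0}) (x :: real^'n) \<partial>lborel) =
      (\<integral>\<^sup>+x. g (sgn x) * indicator (ball 0 1) (x :: real^'n) \<partial>lborel)"
    by (intro nn_integral_cong_AE eventually_mono[OF AE_lborel_singleton[of 0]])
       (simp add: indicator_def)
  finally show ?thesis .
qed

lemma finite_measure_sphere_measure: "finite_measure (sphere_measure :: (real^'n) measure)"
proof
  have "emeasure (sphere_measure :: (real^'n) measure) (space sphere_measure) = (\<integral>\<^sup>+p. 1 \<partial>(sphere_measure :: (real^'n) measure))"
    by simp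
  also have "\<dots> = of_nat CARD('n) * emeasure lborel (ball (0::real^'n) 1)"
    by (subst nn_integral_sphere_measure) simp_all
  also have "\<dots> < \<infinity>"
    using emeasure_lborel_ball_finite[of "0::real^'n" 1] by (simp add: ennreal_mult_less_top of_nat_less_top)
  finally show "emeasure (sphere_measure :: (real^'n) measure) (space sphere_measure) \<noteq> \<infinity>"
    by simp
qed

interpretation sphere_measure: finite_measure "sphere_measure :: (real^'n) measure"
  by (rule finite_measure_sphere_measure)

text \<open>By homogeneity a shell of width \<open>d\<close> carries the fraction \<open>1 - (1 - d) ^ n \<ge> d\<close> of the integral
  of a radially constant function over the ball.\<close>

lemma nn_integral_sphere_le_shell:
  fixes g :: "real^'n \<Rightarrow> real"
  assumes g [measurable]: "g \<in> borel_measurable borel" and bound: "\<And>x. 0 \<le> g x" "\<And>x. g x \<le> 1"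
    and d: "0 < d" "d < 1"
  shows "ennreal d * (\<integral>\<^sup>+p. g p \<partial>sphere_measure) \<le>
    of_nat CARD('n) * (\<integral>\<^sup>+x. ennreal (g (sgn x)) * indicator (ball 0 1 - ball 0 (1 - d)) (x :: real^'n) \<partial>lborel)"
proof -
  let ?I = "\<lambda>A. (\<integral>\<^sup>+x. ennreal (g (sgn x)) * indicator A (x :: real^'n) \<partial>lborel)"
  have meas: "(\<lambda>x. ennreal (g (sgn x)) * indicator A x) \<in> borel_measurable borel"
    if "A \<in> sets borel" for A
    using that by measurable
  \<comment> \<open>Finiteness allows the splitting into inner ball and shell to be read in the
    reals, where subtraction is available.\<close>
  have "?I (ball 0 1) \<le> (\<integral>\<^sup>+x. indicator (ball 0 1) (x :: real^'n) \<partial>lborel)"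
    using bound by (intro nn_integral_mono) (auto split: split_indicator)
  also have "\<dots> < \<infinity>"
    using emeasure_lborel_ball_finite[of "0::real^'n" 1] by simp
  finally obtain J where J: "0 \<le> J" "?I (ball 0 1) = ennreal J"
    by (cases "?I (ball 0 1)") auto
  have "?I (ball 0 (1 - d)) = ennreal ((1 - d) ^ CARD('n)) * ?I (ball 0 1)"
  proof -
    have "g (sgn ((1 - d) *\<^sub>R x)) = g (sgn x)" for x
      using d by (simp add: sgn_scaleR)
    moreover have "indicator (ball 0 (1 - d)) ((1 - d) *\<^sub>R x) = (indicator (ball 0 1) x :: ennreal)" for x :: "real^'n"
      using d by (auto split: split_indicator)
    ultimately show ?thesis
      using d by (subst nn_integral_lborel_affine[of _ "1 - d" 0]) (auto simp: meas)
  qed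
  then have inner: "?I (ball 0 (1 - d)) = ennreal ((1 - d) ^ CARD('n) * J)"
    using d J by (simp add: ennreal_mult)
  have "?I (ball 0 1) = ?I (ball 0 (1 - d)) + ?I (ball 0 1 - ball 0 (1 - d))"
    using d by (subst nn_integral_add[symmetric]) (auto simp: meas intro!: nn_integral_cong split: split_indicator)
  then obtain J' where J': "0 \<le> J'" "?I (ball 0 1 - ball 0 (1 - d)) = ennreal J'"
    and sum: "J = (1 - d) ^ CARD('n) * J + J'"
    using J d inner by (cases "?I (ball 0 1 - ball 0 (1 - d))") (auto simp: simp flip: ennreal_plus)
  have "(1 - d) ^ CARD('n) \<le> 1 - d"
    using d power_decreasing[of 1 "CARD('n)" "1 - d"] by simp
  then have "(1 - d) ^ CARD('n) * J \<le> (1 - d) * J"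
    using J by (intro mult_right_mono)
  then have "d * J \<le> J'"
    using sum by (simp add: algebra_simps)
  then have "ennreal d * ?I (ball 0 1) \<le> ?I (ball 0 1 - ball 0 (1 - d))"
    using d J J' by (simp flip: ennreal_mult)
  then show ?thesis
    by (subst nn_integral_sphere_measure, simp, subst mult.left_commute) (auto intro: mult_left_mono)
qed

text \<open>A bound, independent of \<kappa>, for the row integrals of the Gaussian kernel. The
  cardinality stems from polar coordinates, the factor 2 from the shell width
  \<open>1 / (2 * \<kappa>)\<close>, \<open>exp (1/8)\<close> from moving \<open>sgn x\<close> to
  \<open>x\<close>, and the power from a Gaussian integral of scale
  \<open>\<kappa> / sqrt 2\<close>. The type argument conveys the dimension.\<close>

definition schur_const :: "'n::finite itself \<Rightarrow> real" where
  "schur_const _ = 2 * CARD('n) * exp (1/8) * (sqrt (2 * pi) * sqrt 2) ^ CARD('n)"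

lemma schur_const_pos: "0 < schur_const TYPE('n::finite)"
  by (simp add: schur_const_def zero_less_power)

text \<open>The surface integral is compared with a volume integral over a thin shell, on which the
  Gaussian at \<open>sgn x\<close> is dominated by a slightly wider Gaussian at \<open>x\<close>.
  The volume integral is of order \<open>\<kappa> ^ (- n)\<close>, and division by the shell width
  gives back one factor \<kappa>.\<close>

lemma nn_integral_sphere_gaussian_le:
  fixes p :: "real^'n"
  assumes "1 \<le> \<kappa>"
  shows "ennreal (\<kappa> ^ (CARD('n) - 1)) * (\<integral>\<^sup>+q. exp (- (\<kappa> * norm (q - p))\<^sup>2 / 2) \<partial>sphere_measure)
    \<le> ennreal (schur_const TYPE('n))"
proof -
  let ?n = "CARD('n)"
  \<comment> \<open>The width matches the length scale \<open>1 / \<kappa>\<close> of the Gaussian,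
    so that moving by \<open>?d\<close> costs only a constant factor. As
    \<open>\<kappa> \<ge> 1\<close>, the shell stays away from the origin.\<close>
  let ?d = "1 / (2 * \<kappa>)"
  let ?D = "(sqrt (2 * pi) * sqrt 2) ^ ?n"
  have pointwise: "exp (- (\<kappa> * norm (sgn x - p))\<^sup>2 / 2)
      \<le> exp (1/8) * exp (- (\<kappa> / sqrt 2 * norm (x - p))\<^sup>2 / 2)"
    if x: "x \<in> ball 0 1 - ball 0 (1 - ?d)" for x
  proof -
    have "1 - ?d \<ge> 1/2"
      using assms by (simp add: field_simps)
    with x have nx: "0 < norm x" "norm x < 1" "1 - ?d \<le> norm x"
      by auto
    then have "x \<noteq> 0" by auto
    then have "x - sgn x = (norm x - 1) *\<^sub>R sgn x"
      by (simp add: sgn_div_norm algebra_simps)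
    then have "norm (x - sgn x) = \<bar>norm x - 1\<bar>"
      using \<open>x \<noteq> 0\<close> by (simp add: norm_sgn)
    then have "norm (x - sgn x) \<le> ?d"
      using nx by simp
    moreover have "norm (x - p) \<le> norm (x - sgn x) + norm (sgn x - p)"
      by norm
    ultimately have "norm (x - p) \<le> ?d + norm (sgn x - p)"
      by linarith
    then have "\<kappa> * norm (x - p) \<le> \<kappa> * (?d + norm (sgn x - p))"
      using assms by (intro mult_left_mono) auto
    also have "\<dots> = 1/2 + \<kappa> * norm (sgn x - p)"
      using assms by (simp add: field_simps)
    finally have "(\<kappa> * norm (x - p))\<^sup>2 \<le> (1/2 + \<kappa> * norm (sgn x - p))\<^sup>2"
      using assms by (intro power_mono) auto
    \<comment> \<open>By \<open>(a + b)^2 \<le> 2 a^2 + 2 b^2\<close>; in the exponent this costs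
      the summand \<open>1/8\<close> and lowers the scale from \<kappa> to
      \<open>\<kappa> / sqrt 2\<close>.\<close>
    also have "\<dots> \<le> 2 * (1/2)\<^sup>2 + 2 * (\<kappa> * norm (sgn x - p))\<^sup>2"
      using sum_squares_ge_zero[of "1/2 - \<kappa> * norm (sgn x - p)" 0] by (simp add: power2_eq_square algebra_simps)
    finally have "- (\<kappa> * norm (sgn x - p))\<^sup>2 / 2 \<le> 1/8 + - ((\<kappa> * norm (x - p))\<^sup>2 / 2) / 2"
      by (simp add: power2_eq_square)
    also have "(\<kappa> * norm (x - p))\<^sup>2 / 2 = (\<kappa> / sqrt 2 * norm (x - p))\<^sup>2"
      by (simp add: power_mult_distrib power_divide)
    finally show ?thesis
      by (simp only: exp_le_cancel_iff flip: exp_add)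
  qed
  have "ennreal ?d * (\<integral>\<^sup>+q. exp (- (\<kappa> * norm (q - p))\<^sup>2 / 2) \<partial>sphere_measure) \<le>
      of_nat ?n * (\<integral>\<^sup>+x. ennreal (exp (- (\<kappa> * norm (sgn x - p))\<^sup>2 / 2)) * indicator (ball 0 1 - ball 0 (1 - ?d)) x \<partial>lborel)"
    using assms by (intro nn_integral_sphere_le_shell) auto
  also have "\<dots> \<le> of_nat ?n * (\<integral>\<^sup>+x. ennreal (exp (1/8)) * ennreal (exp (- (\<kappa> / sqrt 2 * norm (x - p))\<^sup>2 / 2)) \<partial>lborel)"
    using pointwise
    by (intro mult_left_mono nn_integral_mono) (auto split: split_indicator simp flip: ennreal_mult)
  also have "\<dots> = of_nat ?n * (ennreal (exp (1/8)) * ennreal ((sqrt (2 * pi) / (\<kappa> / sqrt 2)) ^ ?n))"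
    using assms by (subst nn_integral_cmult, simp, subst nn_integral_gaussian) auto
  also have "\<dots> = ennreal (?n * exp (1/8) * ?D / \<kappa> ^ ?n)"
    using assms by (simp add: power_divide ennreal_of_nat_eq_real_of_nat mult.assoc flip: ennreal_mult)
  finally have *: "ennreal ?d * (\<integral>\<^sup>+q. exp (- (\<kappa> * norm (q - p))\<^sup>2 / 2) \<partial>sphere_measure)
    \<le> ennreal (?n * exp (1/8) * ?D / \<kappa> ^ ?n)" .
  have pw: "\<kappa> ^ ?n = \<kappa> * \<kappa> ^ (?n - 1)"
    by (metis Suc_diff_1 power_Suc zero_less_card_finite)
  have "ennreal (\<kappa> ^ (?n - 1)) * (\<integral>\<^sup>+q. exp (- (\<kappa> * norm (q - p))\<^sup>2 / 2) \<partial>sphere_measure) =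
      ennreal (2 * \<kappa> ^ ?n) * (ennreal ?d * (\<integral>\<^sup>+q. exp (- (\<kappa> * norm (q - p))\<^sup>2 / 2) \<partial>sphere_measure))"
    using assms by (simp add: pw flip: mult.assoc ennreal_mult)
  also have "\<dots> \<le> ennreal (2 * \<kappa> ^ ?n) * ennreal (?n * exp (1/8) * ?D / \<kappa> ^ ?n)"
    by (intro mult_left_mono *) simp
  also have "\<dots> = ennreal (schur_const TYPE('n))"
    using assms by (subst ennreal_mult[symmetric]) (auto simp: schur_const_def mult_ac)
  finally show ?thesis .
qed

subsection \<open>Uniform boundedness of \<open>A\<^sub>\<kappa>\<close>\<close>

text \<open>Since \<open>2 |u p u q| \<le> (u p)^2 + (u q)^2\<close>, the form is bounded by two
  integrals, which agree by the symmetry of \<open>K\<close> and are controlled by the row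
  integrals. Nonnegative integrals are used so that the iterated integrals can be exchanged
  freely.\<close>

lemma (in sigma_finite_measure) schur_test:
  fixes u :: "'a \<Rightarrow> real" and K :: "'a \<Rightarrow> 'a \<Rightarrow> real"
  assumes [measurable]: "u \<in> borel_measurable M" "case_prod K \<in> borel_measurable (M \<Otimes>\<^sub>M M)"
    and nonneg: "\<And>p q. 0 \<le> K p q" and sym: "\<And>p q. K p q = K q p"
    and row: "\<And>p. p \<in> space M \<Longrightarrow> (\<integral>\<^sup>+q. K p q \<partial>M) \<le> B"
  shows "(\<integral>\<^sup>+z. \<bar>u (fst z) * u (snd z)\<bar> * K (fst z) (snd z) \<partial>(M \<Otimes>\<^sub>M M)) \<le> B * (\<integral>\<^sup>+p. (u p)\<^sup>2 \<partial>M)"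
proof -
  note iterated_integral = nn_integral_fst[where ?M1.0 = M]
  interpret pair_sigma_finite M M ..
  let ?N = "M \<Otimes>\<^sub>M M"
  have [measurable]: "(\<lambda>z. K (fst z) (snd z)) \<in> borel_measurable ?N"
    using assms(2) by (simp add: case_prod_beta')
  have row': "(\<integral>\<^sup>+p. \<integral>\<^sup>+q. (u p)\<^sup>2 * K p q \<partial>M \<partial>M) \<le> B * (\<integral>\<^sup>+p. (u p)\<^sup>2 \<partial>M)"
  proof -
    have "(\<integral>\<^sup>+p. \<integral>\<^sup>+q. (u p)\<^sup>2 * K p q \<partial>M \<partial>M) = (\<integral>\<^sup>+p. (u p)\<^sup>2 * (\<integral>\<^sup>+q. K p q \<partial>M) \<partial>M)"
      by (intro nn_integral_cong)
         (simp add: ennreal_mult nonneg nn_integral_cmult)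
    also have "\<dots> \<le> (\<integral>\<^sup>+p. B * (u p)\<^sup>2 \<partial>M)"
      by (intro nn_integral_mono, subst mult.commute) (auto intro!: mult_right_mono row)
    also have "\<dots> = B * (\<integral>\<^sup>+p. (u p)\<^sup>2 \<partial>M)"
      by (intro nn_integral_cmult) simp
    finally show ?thesis .
  qed
  have "2 * (\<integral>\<^sup>+z. \<bar>u (fst z) * u (snd z)\<bar> * K (fst z) (snd z) \<partial>?N) =
      (\<integral>\<^sup>+z. 2 * ennreal (\<bar>u (fst z) * u (snd z)\<bar> * K (fst z) (snd z)) \<partial>?N)"
    by (intro nn_integral_cmult[symmetric]) simp
  also have "\<dots> \<le> (\<integral>\<^sup>+z. ennreal ((u (fst z))\<^sup>2 * K (fst z) (snd z)) + ennreal ((u (snd z))\<^sup>2 * K (fst z) (snd z)) \<partial>?N)"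
  proof (intro nn_integral_mono)
    fix z
    have "2 * \<bar>u (fst z) * u (snd z)\<bar> \<le> (u (fst z))\<^sup>2 + (u (snd z))\<^sup>2"
      using sum_squares_bound[of "\<bar>u (fst z)\<bar>" "\<bar>u (snd z)\<bar>"] by (simp add: abs_mult)
    from mult_right_mono[OF this nonneg[of "fst z" "snd z"]]
    show "2 * ennreal (\<bar>u (fst z) * u (snd z)\<bar> * K (fst z) (snd z))
      \<le> ennreal ((u (fst z))\<^sup>2 * K (fst z) (snd z)) + ennreal ((u (snd z))\<^sup>2 * K (fst z) (snd z))"
      by (simp add: nonneg distrib_right mult.assoc ennreal_leI
          flip: ennreal_plus ennreal_numeral ennreal_mult)
  qed
  also have "\<dots> = (\<integral>\<^sup>+z. (u (fst z))\<^sup>2 * K (fst z) (snd z) \<partial>?N) + (\<integral>\<^sup>+z. (u (snd z))\<^sup>2 * K (fst z) (snd z) \<partial>?N)"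
    by (intro nn_integral_add) auto
  also have "(\<integral>\<^sup>+z. (u (fst z))\<^sup>2 * K (fst z) (snd z) \<partial>?N) = (\<integral>\<^sup>+p. \<integral>\<^sup>+q. (u p)\<^sup>2 * K p q \<partial>M \<partial>M)"
    using iterated_integral[of "\<lambda>z. ennreal ((u (fst z))\<^sup>2 * K (fst z) (snd z))"] by simp
  also have "(\<integral>\<^sup>+z. (u (snd z))\<^sup>2 * K (fst z) (snd z) \<partial>?N) = (\<integral>\<^sup>+q. \<integral>\<^sup>+p. (u q)\<^sup>2 * K q p \<partial>M \<partial>M)"
    using nn_integral_snd[of "\<lambda>z. ennreal ((u (snd z))\<^sup>2 * K (fst z) (snd z))"]
    by (simp add: sym)
  finally have "2 * (\<integral>\<^sup>+z. \<bar>u (fst z) * u (snd z)\<bar> * K (fst z) (snd z) \<partial>?N)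
    \<le> 2 * (B * (\<integral>\<^sup>+p. (u p)\<^sup>2 \<partial>M))"
    using row' by (simp add: mult_2) (meson add_mono order_trans)
  then show ?thesis
    by (simp add: ennreal_mult_le_mult_iff)
qed

section \<open>The Gaussian-weighted norm of the Herglotz transform as a quadratic form on the
  sphere\<close>

lemma herglotz_measurable [measurable]:
  fixes f :: "real^'n \<Rightarrow> complex"
  assumes [measurable]: "f \<in> borel_measurable sphere_measure"
  shows "herglotz \<kappa> f \<in> borel_measurable borel"
proof -
  \<comment> \<open>The sphere carries the trace sigma-algebra, so its inclusion into the ambient
    space has to be declared measurable.\<close>
  have [measurable]: "(\<lambda>p. p) \<in> borel_measurable (sphere_measure :: (real^'n) measure)"
    by (simp add: measurable_restrict_space1 cong: measurable_cong_sets)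
  show ?thesis
    unfolding herglotz_def[abs_def] by measurable
qed

text \<open>On a finite measure space \<open>|f|\<close> is dominated by
  \<open>1 + |f|^2\<close>.\<close>

lemma L2_integrable:
  assumes "finite_measure M" "f \<in> L2 M"
  shows "integrable M f"
proof (rule Bochner_Integration.integrable_bound)
  interpret finite_measure M by fact
  show "integrable M (\<lambda>x. 1 + (cmod (f x))\<^sup>2)"
    using assms by (auto simp: L2_def)
  show "AE x in M. cmod (f x) \<le> norm (1 + (cmod (f x))\<^sup>2)"
  proof (intro AE_I2)
    fix x
    have "0 \<le> (1 - cmod (f x))\<^sup>2 + cmod (f x)" "0 \<le> cmod (f x)" by auto
    then show "cmod (f x) \<le> norm (1 + (cmod (f x))\<^sup>2)"
      by (simp add: power2_eq_square algebra_simps)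
  qed
qed (use assms in \<open>auto simp: L2_def\<close>)

lemma integrable_pair_mult:
  fixes f g :: "'a \<Rightarrow> complex"
  assumes "sigma_finite_measure M" "integrable M f" "integrable M g"
  shows "integrable (M \<Otimes>\<^sub>M M) (\<lambda>z. f (fst z) * g (snd z))"
proof -
  interpret M: sigma_finite_measure M by fact
  interpret pair_sigma_finite M M ..
  note [measurable] = borel_measurable_integrable[OF assms(2)] borel_measurable_integrable[OF assms(3)]
  show ?thesis
    by (rule Fubini_integrable) (auto simp: norm_mult intro!: assms integrable_norm)
qed

text \<open>The squared modulus of the transform is a double integral over the sphere with phase
  \<open>\<kappa> (p - q) \<bullet> x\<close>. Integrating in \<open>x\<close> first yields the
  Fourier transform of the Gaussian at \<open>\<kappa> (p - q)\<close>.\<close>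

lemma gaussian_weighted_herglotz:
  fixes f :: "real^'n \<Rightarrow> complex"
  assumes "f \<in> L2 sphere_measure"
  shows "has_bochner_integral lborel (\<lambda>x. complex_of_real (gaussian_density x * (cmod (herglotz \<kappa> f x))\<^sup>2))
    (\<integral>z. f (fst z) * cnj (f (snd z)) * exp (- (\<kappa> * norm (snd z - fst z))\<^sup>2 / 2)
      \<partial>(sphere_measure \<Otimes>\<^sub>M sphere_measure))"
proof -
  let ?S = "sphere_measure :: (real^'n) measure"
  let ?N = "?S \<Otimes>\<^sub>M ?S"
  interpret S: pair_sigma_finite ?S ?S ..
  interpret N: sigma_finite_measure ?N ..
  interpret NL: pair_sigma_finite ?N "lborel :: (real^'n) measure" ..
  have f: "integrable ?S f"
    using assms by (intro L2_integrable finite_measure_sphere_measure)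
  have [measurable]: "f \<in> borel_measurable ?S"
    using f by auto
  have [measurable]: "(\<lambda>p. p) \<in> borel_measurable ?S"
    by (simp add: measurable_restrict_space1 cong: measurable_cong_sets)
  define e where "e p x = iexp (\<kappa> * (p \<bullet> x))" for p x :: "real^'n"
  have [measurable]: "(\<lambda>p. e p x) \<in> borel_measurable ?S" for x
    unfolding e_def by measurable
  define h where "h z = f (fst z) * cnj (f (snd z))" for z
  have h: "integrable ?N h"
    unfolding h_def by (rule integrable_pair_mult) (auto intro: f sphere_measure.sigma_finite_measure_axioms)
  define F where "F z x = complex_of_real (gaussian_density x) * (h z * (e (fst z) x * cnj (e (snd z) x)))" for z x
  have e_mult: "e p x * cnj (e q x) = iexp ((\<kappa> *\<^sub>R (p - q)) \<bullet> x)" for p q x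
    by (simp add: e_def exp_cnj inner_diff_left algebra_simps flip: exp_add)
  have square: "complex_of_real (gaussian_density x * (cmod (herglotz \<kappa> f x))\<^sup>2) = (\<integral>z. F z x \<partial>?N)" for x
  proof -
    let ?H = "herglotz \<kappa> f x"
    have int: "integrable ?S (\<lambda>p. e p x * f p)"
      by (rule Bochner_Integration.integrable_bound[OF f]) (auto simp: norm_mult e_def)
    then have int2: "integrable ?N (\<lambda>z. (e (fst z) x * f (fst z)) * cnj (e (snd z) x * f (snd z)))"
      by (intro integrable_pair_mult integrable_cnj) (auto intro: sphere_measure.sigma_finite_measure_axioms)
    have H: "?H = (\<integral>p. e p x * f p \<partial>?S)"
      by (simp add: herglotz_def e_def)
    have "(\<integral>z. (e (fst z) x * f (fst z)) * cnj (e (snd z) x * f (snd z)) \<partial>?N) =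
        (\<integral>p. \<integral>q. (e p x * f p) * cnj (e q x * f q) \<partial>?S \<partial>?S)"
      using S.integral_fst'[OF int2] by simp
    also have "\<dots> = (\<integral>p. (e p x * f p) * cnj ?H \<partial>?S)"
      unfolding H integral_mult_right_zero by (subst Bochner_Integration.integral_cnj) simp
    also have "\<dots> = ?H * cnj ?H"
      unfolding H by (simp only: integral_mult_left_zero)
    finally have "complex_of_real (gaussian_density x) * (?H * cnj ?H) = (\<integral>z. F z x \<partial>?N)"
      by (simp add: F_def h_def mult_ac)
    then show ?thesis
      by (simp only: of_real_mult complex_norm_square)
  qed
  have inner: "has_bochner_integral lborel (\<lambda>x. F z x) (h z * exp (- (\<kappa> * norm (snd z - fst z))\<^sup>2 / 2))" for z
  proof -
    have "has_bochner_integral lborel (\<lambda>x. h z * (complex_of_real (gaussian_density x) * iexp ((\<kappa> *\<^sub>R (fst z - snd z)) \<bullet> x)))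
       (h z * complex_of_real (exp (- (norm (\<kappa> *\<^sub>R (fst z - snd z)))\<^sup>2 / 2)))"
      by (intro has_bochner_integral_mult_right gaussian_density_fourier)
    moreover have "(norm (\<kappa> *\<^sub>R (fst z - snd z)))\<^sup>2 = (\<kappa> * norm (snd z - fst z))\<^sup>2"
      by (simp add: power_mult_distrib norm_minus_commute)
    ultimately show ?thesis
      by (simp add: F_def e_mult mult_ac)
  qed
  have gauss: "integrable lborel (gaussian_density :: real^'n \<Rightarrow> real)"
    using gaussian_density_fourier[of "0::real^'n"]
    by (simp add: has_bochner_integral_iff complex_of_real_integrable_eq)
  have [measurable]: "h \<in> borel_measurable ?N"
    using h by auto
  have meas: "(\<lambda>(z, x). F z x) \<in> borel_measurable (?N \<Otimes>\<^sub>M lborel)"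
  proof -
    let ?P = "?N \<Otimes>\<^sub>M (lborel :: (real^'n) measure)"
    have "(\<lambda>w. fst (fst w)) \<in> measurable ?P ?S" "(\<lambda>w. snd (fst w)) \<in> measurable ?P ?S"
      by measurable
    from this[THEN measurable_compose[where g="\<lambda>p. p" and L=borel]]
    have "(\<lambda>w. fst (fst w)) \<in> borel_measurable ?P" "(\<lambda>w. snd (fst w)) \<in> borel_measurable ?P"
      by simp_all
    moreover have "snd \<in> borel_measurable ?P"
      using measurable_snd[of ?N "lborel :: (real^'n) measure"] by (simp cong: measurable_cong_sets)
    ultimately have inner: "(\<lambda>w. fst (fst w) \<bullet> snd w) \<in> borel_measurable ?P"
      "(\<lambda>w. snd (fst w) \<bullet> snd w) \<in> borel_measurable ?P"
      by (auto intro: borel_measurable_inner)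
    have "(\<lambda>y. iexp (\<kappa> * y)) \<in> borel_measurable borel"
      by measurable
    from inner[THEN measurable_compose, OF this]
    have [measurable]: "(\<lambda>w. e (fst (fst w)) (snd w)) \<in> borel_measurable ?P"
      "(\<lambda>w. e (snd (fst w)) (snd w)) \<in> borel_measurable ?P"
      by (simp_all add: e_def)
    have [measurable]: "cnj \<in> borel_measurable borel"
      by (intro borel_measurable_continuous_onI continuous_intros)
    show ?thesis
      unfolding F_def case_prod_beta' by measurable
  qed
  \<comment> \<open>The exponentials have modulus one, so the modulus of \<open>F\<close> splits
    into a function of \<open>z\<close> and a function of \<open>x\<close>, both integrable. This
    justifies Fubini's theorem.\<close>
  have normF: "norm (F z x) = cmod (h z) * gaussian_density x" for z x
    using gaussian_density_pos[of x] by (simp add: F_def e_def norm_mult)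
  have intF: "integrable (?N \<Otimes>\<^sub>M lborel) (\<lambda>(z, x). F z x)"
  proof (rule NL.Fubini_integrable[OF meas])
    show "integrable ?N (\<lambda>z. \<integral>x. norm (case (z, x) of (z, x) \<Rightarrow> F z x) \<partial>lborel)"
      using h by (simp add: normF)
  qed (use inner in \<open>auto simp: has_bochner_integral_iff\<close>)
  show ?thesis
    unfolding square has_bochner_integral_iff
  proof
    show "integrable lborel (\<lambda>x. \<integral>z. F z x \<partial>?N)"
      using NL.integrable_snd[OF intF] by simp
    have "(\<integral>x. \<integral>z. F z x \<partial>?N \<partial>lborel) = (\<integral>z. \<integral>x. F z x \<partial>lborel \<partial>?N)"
      using NL.Fubini_integral[OF intF] by simp
    also have "\<dots> = (\<integral>z. h z * exp (- (\<kappa> * norm (snd z - fst z))\<^sup>2 / 2) \<partial>?N)"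
      using inner by (simp add: has_bochner_integral_iff)
    finally show "(\<integral>x. \<integral>z. F z x \<partial>?N \<partial>lborel) =
      (\<integral>z. f (fst z) * cnj (f (snd z)) * exp (- (\<kappa> * norm (snd z - fst z))\<^sup>2 / 2) \<partial>?N)"
      by (simp add: h_def)
  qed
qed

text \<open>Schur's test applied to the Gaussian kernel. The factor
  \<open>\<kappa> ^ (n - 1)\<close> is the square of the normalisation of
  \<open>scaled_herglotz\<close> and is exactly what makes the row integrals bounded uniformly in
  \<kappa>.\<close>

lemma gaussian_weighted_herglotz_le:
  fixes f :: "real^'n \<Rightarrow> complex"
  assumes f: "f \<in> L2 sphere_measure" and "1 \<le> \<kappa>"
  shows "\<kappa> ^ (CARD('n) - 1) * (\<integral>x. gaussian_density x * (cmod (herglotz \<kappa> f x))\<^sup>2 \<partial>lborel)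
    \<le> schur_const TYPE('n) * (L2_norm sphere_measure f)\<^sup>2"
proof -
  let ?S = "sphere_measure :: (real^'n) measure"
  let ?N = "?S \<Otimes>\<^sub>M ?S"
  define k where "k = \<kappa> ^ (CARD('n) - 1)"
  have k: "0 < k" using assms by (simp add: k_def)
  define K where "K p q = k * exp (- (\<kappa> * norm (q - p))\<^sup>2 / 2)" for p q :: "real^'n"
  define I where "I = (\<integral>x. gaussian_density x * (cmod (herglotz \<kappa> f x))\<^sup>2 \<partial>lborel)"
  have [measurable]: "f \<in> borel_measurable ?S"
    using f by (auto simp: L2_def)
  have [measurable]: "(\<lambda>p. p) \<in> borel_measurable ?S"
    by (simp add: measurable_restrict_space1 cong: measurable_cong_sets)
  have K_meas [measurable]: "case_prod K \<in> borel_measurable ?N"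
    unfolding K_def by measurable
  have row: "(\<integral>\<^sup>+q. K p q \<partial>?S) \<le> ennreal (schur_const TYPE('n))" for p
    using nn_integral_sphere_gaussian_le[of \<kappa> p] assms k
    by (simp add: K_def ennreal_mult nn_integral_cmult k_def)
  have K_pos: "0 \<le> K p q" for p q
    using k by (simp add: K_def)
  have I0: "0 \<le> I"
    unfolding I_def by (intro integral_nonneg_AE AE_I2) (simp add: less_imp_le gaussian_density_pos)
  have "complex_of_real I = (\<integral>z. f (fst z) * cnj (f (snd z)) * exp (- (\<kappa> * norm (snd z - fst z))\<^sup>2 / 2) \<partial>?N)"
    using gaussian_weighted_herglotz[OF f, of \<kappa>] unfolding I_def has_bochner_integral_iff
    by (simp del: of_real_mult)
  then have "complex_of_real (k * I) = (\<integral>z. f (fst z) * cnj (f (snd z)) * K (fst z) (snd z) \<partial>?N)"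
    by (simp add: K_def mult_ac)
  then have "k * I = norm (\<integral>z. f (fst z) * cnj (f (snd z)) * K (fst z) (snd z) \<partial>?N)"
    using k I0 by (metis abs_of_nonneg less_imp_le mult_nonneg_nonneg norm_of_real)
  \<comment> \<open>If the integrand is not integrable, its Bochner integral is 0 by convention and
    the bound is trivial.\<close>
  then have "ennreal (k * I) \<le> (\<integral>\<^sup>+z. norm (f (fst z) * cnj (f (snd z)) * K (fst z) (snd z)) \<partial>?N)"
    using integral_norm_bound_ennreal[of ?N "\<lambda>z. f (fst z) * cnj (f (snd z)) * K (fst z) (snd z)"]
    by (cases "integrable ?N (\<lambda>z. f (fst z) * cnj (f (snd z)) * K (fst z) (snd z))")
       (auto simp: not_integrable_integral_eq)
  also have "\<dots> = (\<integral>\<^sup>+z. \<bar>cmod (f (fst z)) * cmod (f (snd z))\<bar> * K (fst z) (snd z) \<partial>?N)"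
    using K_pos by (simp add: norm_mult abs_mult)
  also have "\<dots> \<le> ennreal (schur_const TYPE('n)) * (\<integral>\<^sup>+p. (cmod (f p))\<^sup>2 \<partial>?S)"
    by (intro sphere_measure.schur_test K_meas K_pos row) (auto simp: K_def norm_minus_commute)
  also have "(\<integral>\<^sup>+p. (cmod (f p))\<^sup>2 \<partial>?S) = ennreal ((L2_norm ?S f)\<^sup>2)"
    using f by (subst nn_integral_eq_integral) (auto simp: L2_def L2_norm_def)
  finally have "ennreal (k * I) \<le> ennreal (schur_const TYPE('n) * (L2_norm ?S f)\<^sup>2)"
    using schur_const_pos[where 'n='n] by (simp add: ennreal_mult)
  then show ?thesis
    using schur_const_pos[where 'n='n] by (simp add: k_def I_def)
qed

text \<open>The Gaussian density is bounded below on the unit ball, so the norm over the ball is at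
  most a constant times the Gaussian-weighted norm over the whole space.\<close>

lemma scaled_herglotz_bounded:
  "\<exists>C>0. \<forall>\<kappa>\<ge>1. \<forall>f\<in>L2 (sphere_measure :: (real^'n) measure).
     L2_norm (lebesgue_on (ball 0 1)) (scaled_herglotz \<kappa> f) \<le> C * L2_norm sphere_measure f"
proof (intro exI conjI allI impI ballI)
  \<comment> \<open>The value of the density on the unit sphere, hence a lower bound for it on the
    ball.\<close>
  define g where "g = exp (- 1 / 2) / sqrt (2 * pi) ^ CARD('n)"
  have g: "0 < g" by (simp add: g_def)
  show "0 < sqrt (schur_const TYPE('n) / g)"
    using g schur_const_pos[where 'n='n] by simp
  fix \<kappa> :: real and f :: "real^'n \<Rightarrow> complex"
  assume \<kappa>: "1 \<le> \<kappa>" and f: "f \<in> L2 sphere_measure"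
  let ?k = "\<kappa> ^ (CARD('n) - 1)"
  let ?w = "\<lambda>x. gaussian_density x * (cmod (herglotz \<kappa> f x))\<^sup>2"
  have [measurable]: "f \<in> borel_measurable sphere_measure"
    using f by (auto simp: L2_def)
  have int: "integrable lborel ?w"
    using gaussian_weighted_herglotz[OF f, of \<kappa>] unfolding has_bochner_integral_iff
    by (simp add: complex_of_real_integrable_eq del: of_real_mult)
  have sq: "(cmod (scaled_herglotz \<kappa> f x))\<^sup>2 = ?k * (cmod (herglotz \<kappa> f x))\<^sup>2" for x
  proof -
    have "(\<kappa> powr ((real CARD('n) - 1) / 2))\<^sup>2 = \<kappa> powr (real (CARD('n) - 1))"
      using \<kappa> by (simp add: power2_eq_square of_nat_diff Suc_leI flip: powr_add)
    also have "\<dots> = ?k"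
      using \<kappa> by (intro powr_realpow) simp
    finally show ?thesis
      by (simp add: scaled_herglotz_def norm_mult power_mult_distrib)
  qed
  have lower: "g \<le> gaussian_density x" if "x \<in> ball 0 1" for x :: "real^'n"
  proof -
    have "(norm x)\<^sup>2 \<le> 1" using that by (simp add: power_le_one)
    then show ?thesis by (simp add: g_def gaussian_density_def divide_right_mono)
  qed
  have "(\<integral>x. (cmod (scaled_herglotz \<kappa> f x))\<^sup>2 \<partial>lebesgue_on (ball 0 1)) =
      (\<integral>x. indicator (ball 0 1) x * (?k * (cmod (herglotz \<kappa> f x))\<^sup>2) \<partial>lborel)"
  proof -
    have [measurable]: "ball (0 :: real^'n) 1 \<in> sets borel"
      by simp
    \<comment> \<open>The integrand is Borel measurable, so its integrals against
      \<open>lebesgue\<close> and \<open>lborel\<close> agree.\<close>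
    have "(\<lambda>x. indicat_real (ball 0 1) x *\<^sub>R (?k * (cmod (herglotz \<kappa> f x))\<^sup>2)) \<in> borel_measurable lborel"
      by measurable
    then show ?thesis
      unfolding sq by (subst integral_restrict_space, simp, subst integral_completion) auto
  qed
  also have "\<dots> \<le> (\<integral>x. ?k / g * ?w x \<partial>lborel)"
  proof (rule integral_mono')
    show "integrable lborel (\<lambda>x. ?k / g * ?w x)"
      using int by simp
    show "0 \<le> ?k / g * ?w x" for x
      using \<kappa> g gaussian_density_pos[of x] by simp
    show "indicator (ball 0 1) x * (?k * (cmod (herglotz \<kappa> f x))\<^sup>2) \<le> ?k / g * ?w x" for x
    proof (cases "x \<in> ball 0 1")
      case True
      then have "1 * (?k * (cmod (herglotz \<kappa> f x))\<^sup>2) \<le> gaussian_density x / g * (?k * (cmod (herglotz \<kappa> f x))\<^sup>2)"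
        using lower g \<kappa> by (intro mult_right_mono) (auto simp: field_simps)
      with True show ?thesis by (simp add: mult_ac)
    qed (use \<kappa> g gaussian_density_pos[of x] in simp)
  qed
  also have "\<dots> = ?k * (\<integral>x. ?w x \<partial>lborel) / g"
    by simp
  also have "\<dots> \<le> schur_const TYPE('n) * (L2_norm sphere_measure f)\<^sup>2 / g"
    using gaussian_weighted_herglotz_le[OF f \<kappa>] g by (intro divide_right_mono) auto
  finally show "L2_norm (lebesgue_on (ball 0 1)) (scaled_herglotz \<kappa> f)
      \<le> sqrt (schur_const TYPE('n) / g) * L2_norm sphere_measure f"
    by (subst (1) L2_norm_def) (auto simp: L2_norm_def real_sqrt_mult[symmetric] intro!: real_sqrt_le_mono)
qed

subsection \<open>Orthogonality to polynomials\<close>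

text \<open>A homogeneous linear system with fewer equations than unknowns has a nonzero solution.
  Gaussian elimination removes one equation, and at most one unknown, in each induction
  step.\<close>

lemma exists_nontrivial_solution:
  fixes a :: "'i \<Rightarrow> 'j \<Rightarrow> 'k::field"
  assumes "finite J" "finite I" "card J < card I"
  shows "\<exists>c. (\<exists>i\<in>I. c i \<noteq> 0) \<and> (\<forall>j\<in>J. (\<Sum>i\<in>I. c i * a i j) = 0)"
  using assms
proof (induction J arbitrary: I a rule: finite_induct)
  case empty
  then have "I \<noteq> {}" by auto
  then show ?case by (intro exI[of _ "\<lambda>_. 1"]) auto
next
  case (insert j J)
  show ?case
  proof (cases "\<forall>i\<in>I. a i j = 0")
    case True
    from insert.IH[of I a] insert.prems insert.hyps show ?thesis
      using True by auto
  next
    case False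
    then obtain i0 where i0: "i0 \<in> I" "a i0 j \<noteq> 0" by auto
    define I' where "I' = I - {i0}"
    have I': "finite I'" "i0 \<notin> I'" "I = insert i0 I'"
      using insert.prems i0 by (auto simp: I'_def)
    have "card J < card I'"
      using insert.prems insert.hyps I' by simp
    \<comment> \<open>Subtracting a multiple of equation \<open>j\<close> from each other equation
      eliminates the unknown \<open>i0\<close>.\<close>
    from insert.IH[OF I'(1) this, of "\<lambda>i m. a i m - a i j / a i0 j * a i0 m"]
    obtain c where c: "\<exists>i\<in>I'. c i \<noteq> 0"
      "\<And>m. m \<in> J \<Longrightarrow> (\<Sum>i\<in>I'. c i * (a i m - a i j / a i0 j * a i0 m)) = 0"
      by blast
    \<comment> \<open>The eliminated unknown, recovered from equation \<open>j\<close>.\<close>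
    define s where "s = - (\<Sum>i\<in>I'. c i * a i j) / a i0 j"
    have sum: "(\<Sum>i\<in>I. (c(i0 := s)) i * a i m) = s * a i0 m + (\<Sum>i\<in>I'. c i * a i m)" for m
    proof -
      have "(\<Sum>i\<in>I'. (c(i0 := s)) i * a i m) = (\<Sum>i\<in>I'. c i * a i m)"
        using I'(2) by (intro sum.cong) auto
      then show ?thesis using I' by simp
    qed
    have "(\<Sum>i\<in>I. (c(i0 := s)) i * a i m) = 0" if "m \<in> insert j J" for m
    proof (cases "m = j")
      case True
      then show ?thesis
        unfolding sum using i0 by (simp add: s_def)
    next
      case False
      then have "m \<in> J" using that by simp
      have "(\<Sum>i\<in>I'. c i * (a i m - a i j / a i0 j * a i0 m)) =
        (\<Sum>i\<in>I'. c i * a i m) - (\<Sum>i\<in>I'. c i * a i j) / a i0 j * a i0 m"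
        by (simp add: right_diff_distrib sum_subtractf sum_divide_distrib sum_distrib_right mult.assoc)
      with c(2)[OF \<open>m \<in> J\<close>] show ?thesis
        unfolding sum by (simp add: s_def)
    qed
    moreover have "\<exists>i\<in>I. (c(i0 := s)) i \<noteq> 0"
      using c(1) I' by auto
    ultimately show ?thesis by blast
  qed
qed

section \<open>Monomials on the sphere and Taylor expansion of plane waves\<close>

definition monomial :: "('n \<Rightarrow> nat) \<Rightarrow> real^'n \<Rightarrow> real" where
  "monomial \<alpha> p = (\<Prod>i\<in>UNIV. (p $ i) ^ \<alpha> i)"

lemma monomial_fun_upd: "monomial (\<alpha>(j := \<alpha> j + k)) p = (p $ j) ^ k * monomial \<alpha> p"
proof -
  have "monomial \<beta> p = (p $ j) ^ \<beta> j * (\<Prod>i\<in>UNIV - {j}. (p $ i) ^ \<beta> i)" for \<beta>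
    unfolding monomial_def by (subst prod.remove[of _ j]) auto
  from this[of "\<alpha>(j := \<alpha> j + k)"] this[of \<alpha>] show ?thesis
    by (simp add: power_add)
qed

lemma sum_fun_upd_add:
  fixes \<alpha> :: "'n::finite \<Rightarrow> nat"
  shows "sum (\<alpha>(j := \<alpha> j + k)) UNIV = sum \<alpha> UNIV + k"
proof -
  have "sum \<beta> UNIV = \<beta> j + (\<Sum>i\<in>UNIV - {j}. \<beta> i)" for \<beta> :: "'n \<Rightarrow> nat"
    by (subst sum.remove[of _ j]) auto
  from this[of "\<alpha>(j := \<alpha> j + k)"] this[of \<alpha>] show ?thesis
    by simp
qed

lemma continuous_on_monomial [continuous_intros]: "continuous_on A (monomial \<alpha>)"
  unfolding monomial_def[abs_def] by (intro continuous_intros)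

text \<open>A continuous weight is bounded on the compact sphere.\<close>

lemma integrable_continuous_mult_sphere:
  fixes f :: "real^'n \<Rightarrow> complex" and g :: "real^'n \<Rightarrow> real"
  assumes g: "continuous_on UNIV g" and f: "integrable sphere_measure f"
  shows "integrable sphere_measure (\<lambda>p. of_real (g p) * f p)"
proof -
  have "bounded (g ` sphere 0 1)"
    by (intro compact_imp_bounded compact_continuous_image continuous_on_subset[OF g]) auto
  then obtain B where B: "\<And>p. p \<in> sphere 0 1 \<Longrightarrow> \<bar>g p\<bar> \<le> B"
    by (metis bounded_iff imageI real_norm_def)
  have "g \<in> borel_measurable borel"
    using g by (rule borel_measurable_continuous_onI)
  then have [measurable]: "g \<in> borel_measurable (sphere_measure :: (real^'n) measure)"
    by (simp add: measurable_restrict_space1 cong: measurable_cong_sets)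
  show ?thesis
  proof (rule Bochner_Integration.integrable_bound)
    show "integrable sphere_measure (\<lambda>p. of_real B * f p)"
      using f by simp
    show "AE p in sphere_measure. norm (of_real (g p) * f p) \<le> norm (of_real B * f p)"
      by (intro AE_I2) (auto simp: norm_mult intro!: mult_right_mono order_trans[OF B])
  qed (use f in measurable)
qed

text \<open>On the sphere \<open>p\<^sub>i\<^sup>2 = 1 - \<Sum>\<^sub>j\<^sub>\<noteq>\<^sub>i p\<^sub>j\<^sup>2\<close>, so the exponent of one fixed coordinate can be lowered below 2
  without raising the degree. This is why orthogonality to polynomials of degree \<open>d\<close> costs only
  \<open>O(d ^ (n - 1))\<close> conditions.\<close>

lemma monomial_orthogonal_reduce:
  fixes f :: "real^'n \<Rightarrow> complex"
  assumes f: "integrable sphere_measure f"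
    and orth: "\<And>\<alpha>. \<alpha> i \<le> 1 \<Longrightarrow> (\<forall>j. \<alpha> j \<le> d) \<Longrightarrow>
      (\<integral>p. of_real (monomial \<alpha> p) * f p \<partial>sphere_measure) = 0"
    and deg: "sum \<alpha> UNIV \<le> d"
  shows "(\<integral>p. of_real (monomial \<alpha> p) * f p \<partial>sphere_measure) = 0"
  using deg
proof (induction "\<alpha> i" arbitrary: \<alpha> rule: less_induct)
  case less
  show ?case
  proof (cases "\<alpha> i \<le> 1")
    case True
    have "\<alpha> j \<le> d" for j
      using member_le_sum[of j UNIV \<alpha>] less.prems by simp
    then show ?thesis using True orth by blast
  next
    case False
    \<comment> \<open>The exponent at \<open>i\<close> is at least 2 here, so the subtraction does
      not truncate.\<close>
    define \<beta> where "\<beta> = \<alpha>(i := \<alpha> i - 2)"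
    have \<alpha>: "\<alpha> = \<beta>(i := \<beta> i + 2)"
      using False by (intro ext) (auto simp: \<beta>_def)
    have "\<beta> i < \<alpha> i"
      using False by (simp add: \<beta>_def)
    have deg: "sum \<beta> UNIV + 2 \<le> d"
      using less.prems sum_fun_upd_add[of \<beta> i 2] \<alpha> by simp
    have int: "integrable sphere_measure (\<lambda>p. of_real (monomial \<gamma> p) * f p)" for \<gamma>
      by (intro integrable_continuous_mult_sphere f continuous_intros)
    have "of_real (monomial \<alpha> p) * f p = of_real (monomial \<beta> p) * f p -
        (\<Sum>j\<in>UNIV - {i}. of_real (monomial (\<beta>(j := \<beta> j + 2)) p) * f p)"
      if "p \<in> space sphere_measure" for p
    proof -
      have "1 = (\<Sum>j\<in>UNIV. (p $ j)\<^sup>2)"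
        using that by (simp add: norm_vec_def L2_set_def)
      also have "\<dots> = (p $ i)\<^sup>2 + (\<Sum>j\<in>UNIV - {i}. (p $ j)\<^sup>2)"
        by (rule sum.remove) auto
      finally have "(p $ i)\<^sup>2 = 1 - (\<Sum>j\<in>UNIV - {i}. (p $ j)\<^sup>2)"
        by simp
      then have "monomial \<alpha> p = monomial \<beta> p - (\<Sum>j\<in>UNIV - {i}. monomial (\<beta>(j := \<beta> j + 2)) p)"
        by (subst \<alpha>, simp only: monomial_fun_upd) (simp add: left_diff_distrib sum_distrib_right)
      then show ?thesis
        by (simp add: left_diff_distrib sum_distrib_right)
    qed
    then have "(\<integral>p. of_real (monomial \<alpha> p) * f p \<partial>sphere_measure) =
        (\<integral>p. of_real (monomial \<beta> p) * f p -
        (\<Sum>j\<in>UNIV - {i}. of_real (monomial (\<beta>(j := \<beta> j + 2)) p) * f p) \<partial>sphere_measure)"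
      by (intro Bochner_Integration.integral_cong) auto
    also have "\<dots> = (\<integral>p. of_real (monomial \<beta> p) * f p \<partial>sphere_measure) -
        (\<Sum>j\<in>UNIV - {i}. (\<integral>p. of_real (monomial (\<beta>(j := \<beta> j + 2)) p) * f p \<partial>sphere_measure))"
      using int by (subst Bochner_Integration.integral_diff) (auto simp: Bochner_Integration.integral_sum)
    also have "\<dots> = 0"
    proof -
      \<comment> \<open>Both kinds of terms have a smaller exponent at \<open>i\<close>: raising
        another exponent by 2 leaves it unchanged and only restores the total degree of
        \<open>\<alpha>\<close>.\<close>
      have "(\<integral>p. of_real (monomial \<beta> p) * f p \<partial>sphere_measure) = 0"
        using deg \<open>\<beta> i < \<alpha> i\<close> by (intro less.hyps) auto
      moreover have "(\<integral>p. of_real (monomial (\<beta>(j := \<beta> j + 2)) p) * f p \<partial>sphere_measure) = 0"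
        if "j \<in> UNIV - {i}" for j
      proof (rule less.hyps)
        show "(\<beta>(j := \<beta> j + 2)) i < \<alpha> i"
          using \<open>\<beta> i < \<alpha> i\<close> that by simp
        show "sum (\<beta>(j := \<beta> j + 2)) UNIV \<le> d"
          using deg by (simp only: sum_fun_upd_add)
      qed
      ultimately show ?thesis by simp
    qed
    finally show ?thesis .
  qed
qed

text \<open>Each factor \<open>p \<bullet> x\<close> is expanded in coordinates and absorbed into
  the monomial. For this induction on \<open>k\<close> the statement carries an arbitrary monomial
  along.\<close>

lemma inner_power_orthogonal:
  fixes f :: "real^'n \<Rightarrow> complex" and x :: "real^'n"
  assumes f: "integrable sphere_measure f"
    and orth: "\<And>\<alpha>. sum \<alpha> UNIV \<le> d \<Longrightarrow> (\<integral>p. of_real (monomial \<alpha> p) * f p \<partial>sphere_measure) = 0"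
    and "k + sum \<alpha> UNIV \<le> d"
  shows "(\<integral>p. of_real ((p \<bullet> x) ^ k * monomial \<alpha> p) * f p \<partial>sphere_measure) = 0"
  using assms(3)
proof (induction k arbitrary: \<alpha>)
  case 0
  then show ?case using orth by simp
next
  case (Suc k)
  let ?t = "\<lambda>j p. of_real ((p \<bullet> x) ^ k * monomial (\<alpha>(j := \<alpha> j + 1)) p) * f p"
  have int: "integrable sphere_measure (?t j)" for j
    by (intro integrable_continuous_mult_sphere f continuous_intros)
  have "of_real ((p \<bullet> x) ^ Suc k * monomial \<alpha> p) * f p = (\<Sum>j\<in>UNIV. of_real (x $ j) * ?t j p)" for p
  proof -
    have "(p \<bullet> x) ^ Suc k * monomial \<alpha> p = (\<Sum>j\<in>UNIV. p $ j * x $ j) * ((p \<bullet> x) ^ k * monomial \<alpha> p)"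
      by (simp add: inner_vec_def)
    also have "\<dots> = (\<Sum>j\<in>UNIV. x $ j * ((p \<bullet> x) ^ k * monomial (\<alpha>(j := \<alpha> j + 1)) p))"
      by (simp only: monomial_fun_upd sum_distrib_right power_one_right) (simp add: mult_ac)
    finally show ?thesis
      by (simp only: of_real_sum of_real_mult sum_distrib_right mult.assoc)
  qed
  then have "(\<integral>p. of_real ((p \<bullet> x) ^ Suc k * monomial \<alpha> p) * f p \<partial>sphere_measure) =
      (\<Sum>j\<in>UNIV. of_real (x $ j) * (\<integral>p. ?t j p \<partial>sphere_measure))"
    using int by (simp add: Bochner_Integration.integral_sum del: of_real_mult of_real_power)
  also have "\<dots> = 0"
  proof (intro sum.neutral ballI)
    fix j
    have "k + sum (\<alpha>(j := \<alpha> j + 1)) UNIV \<le> d"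
      using Suc.prems by (subst sum_fun_upd_add) simp
    then show "of_real (x $ j) * (\<integral>p. ?t j p \<partial>sphere_measure) = 0"
      by (simp only: Suc.IH mult_zero_right)
  qed
  finally show ?case .
qed

text \<open>The Taylor polynomial of degree \<open>d\<close> of the exponential integrates to 0
  against \<open>f\<close>, so only the Taylor remainder contributes to the transform.\<close>

lemma herglotz_le_if_orthogonal:
  fixes f :: "real^'n \<Rightarrow> complex"
  assumes f: "integrable sphere_measure f"
    and orth: "\<And>k. k \<le> d \<Longrightarrow> (\<integral>p. of_real ((p \<bullet> x) ^ k) * f p \<partial>sphere_measure) = 0"
    and x: "norm x \<le> 1" and \<kappa>: "0 \<le> \<kappa>"
  shows "cmod (herglotz \<kappa> f x) \<le> \<kappa> ^ Suc d / fact (Suc d) * (\<integral>p. cmod (f p) \<partial>sphere_measure)"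
proof -
  let ?S = "sphere_measure :: (real^'n) measure"
  let ?T = "\<lambda>p. \<Sum>k\<le>d. (\<i> * of_real (\<kappa> * (p \<bullet> x))) ^ k / fact k :: complex"
  let ?c = "\<lambda>k. (\<i> * of_real \<kappa>) ^ k / fact k :: complex"
  have T: "?T p * f p = (\<Sum>k\<le>d. ?c k * (of_real ((p \<bullet> x) ^ k) * f p))" for p
    unfolding sum_distrib_right by (intro sum.cong) (simp_all add: power_mult_distrib)
  have int: "integrable ?S (\<lambda>p. of_real ((p \<bullet> x) ^ k) * f p)" for k
    by (intro integrable_continuous_mult_sphere f continuous_intros)
  have intT: "integrable ?S (\<lambda>p. ?T p * f p)"
    unfolding T using int by (intro Bochner_Integration.integrable_sum integrable_mult_right) auto
  have "(\<integral>p. ?T p * f p \<partial>?S) = (\<Sum>k\<le>d. ?c k * (\<integral>p. of_real ((p \<bullet> x) ^ k) * f p \<partial>?S))"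
    unfolding T using int by (subst Bochner_Integration.integral_sum) (auto simp del: of_real_power)
  also have "\<dots> = 0"
    using orth by simp
  finally have zero: "(\<integral>p. ?T p * f p \<partial>?S) = 0" .
  have [measurable]: "(\<lambda>p. p) \<in> borel_measurable ?S"
    by (simp add: measurable_restrict_space1 cong: measurable_cong_sets)
  note [measurable] = borel_measurable_integrable[OF f]
  have inte: "integrable ?S (\<lambda>p. iexp (\<kappa> * (p \<bullet> x)) * f p)"
    by (rule Bochner_Integration.integrable_bound[OF f]) (auto simp: norm_mult)
  have bound: "norm (iexp (\<kappa> * (p \<bullet> x)) * f p - ?T p * f p) \<le> \<kappa> ^ Suc d / fact (Suc d) * cmod (f p)"
    if "p \<in> space ?S" for p
  proof -
    have "\<bar>p \<bullet> x\<bar> \<le> norm p * norm x"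
      by (rule Cauchy_Schwarz_ineq2)
    also have "\<dots> \<le> 1" using x that by simp
    finally have "\<bar>\<kappa> * (p \<bullet> x)\<bar> \<le> \<kappa>"
      using \<kappa> by (simp add: abs_mult mult_left_le)
    then have "\<bar>\<kappa> * (p \<bullet> x)\<bar> ^ Suc d / fact (Suc d) \<le> \<kappa> ^ Suc d / fact (Suc d)"
      by (intro divide_right_mono power_mono) auto
    then have "cmod (iexp (\<kappa> * (p \<bullet> x)) - ?T p) \<le> \<kappa> ^ Suc d / fact (Suc d)"
      using iexp_approx1[of "\<kappa> * (p \<bullet> x)" d] by (rule order_trans[rotated])
    then show ?thesis
      by (simp only: norm_mult mult_right_mono norm_ge_zero flip: left_diff_distrib)
  qed
  have "herglotz \<kappa> f x = (\<integral>p. iexp (\<kappa> * (p \<bullet> x)) * f p - ?T p * f p \<partial>?S)"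
    unfolding herglotz_def by (subst Bochner_Integration.integral_diff[OF inte intT]) (simp only: zero diff_zero)
  also have "cmod \<dots> \<le> (\<integral>p. norm (iexp (\<kappa> * (p \<bullet> x)) * f p - ?T p * f p) \<partial>?S)"
    by (rule integral_norm_bound)
  also have "\<dots> \<le> (\<integral>p. \<kappa> ^ Suc d / fact (Suc d) * cmod (f p) \<partial>?S)"
    using inte intT f by (intro integral_mono bound) auto
  finally show ?thesis by simp
qed

text \<open>The exponents are bounded separately, not by their sum, so they fill a box: two choices
  at \<open>i\<close> and \<open>m\<close> at each of the other \<open>n - 1\<close>
  coordinates.\<close>

lemma card_reduced_exponents:
  fixes i :: "'n::finite"
  assumes "1 \<le> m"
  shows "finite {\<alpha> :: 'n \<Rightarrow> nat. \<alpha> i \<le> 1 \<and> (\<forall>j. \<alpha> j < m)}" (is "finite ?J")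
    and "card {\<alpha> :: 'n \<Rightarrow> nat. \<alpha> i \<le> 1 \<and> (\<forall>j. \<alpha> j < m)} \<le> 2 * m ^ (CARD('n) - 1)"
proof -
  let ?B = "\<lambda>j. if j = i then {..1} else {..<m}"
  have sub: "?J \<subseteq> (\<Pi>\<^sub>E j\<in>UNIV. ?B j)"
    by auto
  have fin: "finite (\<Pi>\<^sub>E j\<in>UNIV. ?B j)"
    by (intro finite_PiE) auto
  show "finite ?J"
    using sub fin by (rule finite_subset)
  have "card ?J \<le> card (\<Pi>\<^sub>E j\<in>UNIV. ?B j)"
    using fin sub by (rule card_mono)
  also have "\<dots> = (\<Prod>j\<in>UNIV. card (?B j))"
    by (rule card_PiE) simp
  also have "\<dots> = 2 * (\<Prod>j\<in>UNIV - {i}. card (?B j))"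
    by (subst prod.remove[of _ i]) auto
  also have "(\<Prod>j\<in>UNIV - {i}. card (?B j)) = m ^ (CARD('n) - 1)"
    by (simp add: card_Diff_singleton)
  finally show "card ?J \<le> 2 * m ^ (CARD('n) - 1)" .
qed

subsection \<open>Finite combinations of an orthonormal basis\<close>

lemma L2_inner_integrable:
  assumes "f \<in> L2 M" "g \<in> L2 M"
  shows "integrable M (\<lambda>x. f x * cnj (g x))"
proof (rule Bochner_Integration.integrable_bound)
  show "integrable M (\<lambda>x. (cmod (f x))\<^sup>2 + (cmod (g x))\<^sup>2)"
    using assms by (auto simp: L2_def)
  have [measurable]: "f \<in> borel_measurable M" "g \<in> borel_measurable M"
    using assms by (auto simp: L2_def)
  have [measurable]: "cnj \<in> borel_measurable borel"
    by (intro borel_measurable_continuous_onI continuous_intros)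
  show "(\<lambda>x. f x * cnj (g x)) \<in> borel_measurable M"
    by measurable
  show "AE x in M. norm (f x * cnj (g x)) \<le> norm ((cmod (f x))\<^sup>2 + (cmod (g x))\<^sup>2)"
  proof (intro AE_I2)
    fix x
    have "2 * cmod (f x) * cmod (g x) \<le> (cmod (f x))\<^sup>2 + (cmod (g x))\<^sup>2" "0 \<le> cmod (f x) * cmod (g x)"
      using sum_squares_bound[of "cmod (f x)" "cmod (g x)"] by (auto simp del: zero_le_mult_iff)
    then have "cmod (f x) * cmod (g x) \<le> (cmod (f x))\<^sup>2 + (cmod (g x))\<^sup>2"
      by linarith
    then show "norm (f x * cnj (g x)) \<le> norm ((cmod (f x))\<^sup>2 + (cmod (g x))\<^sup>2)"
      by (simp add: norm_mult)
  qed
qed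

lemma L2_add:
  assumes "f \<in> L2 M" "g \<in> L2 M"
  shows "(\<lambda>x. f x + g x) \<in> L2 M"
proof -
  have [measurable]: "f \<in> borel_measurable M" "g \<in> borel_measurable M"
    using assms by (auto simp: L2_def)
  have "integrable M (\<lambda>x. (cmod (f x + g x))\<^sup>2)"
  proof (rule Bochner_Integration.integrable_bound)
    show "integrable M (\<lambda>x. 2 * (cmod (f x))\<^sup>2 + 2 * (cmod (g x))\<^sup>2)"
      using assms by (auto simp: L2_def)
    show "AE x in M. norm ((cmod (f x + g x))\<^sup>2) \<le> norm (2 * (cmod (f x))\<^sup>2 + 2 * (cmod (g x))\<^sup>2)"
    proof (intro AE_I2)
      fix x
      have "(cmod (f x + g x))\<^sup>2 \<le> (cmod (f x) + cmod (g x))\<^sup>2"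
        by (intro power_mono norm_triangle_ineq) auto
      also have "\<dots> \<le> 2 * (cmod (f x))\<^sup>2 + 2 * (cmod (g x))\<^sup>2"
        using sum_squares_bound[of "cmod (f x)" "cmod (g x)"] by (simp add: power2_sum)
      finally show "norm ((cmod (f x + g x))\<^sup>2) \<le> norm (2 * (cmod (f x))\<^sup>2 + 2 * (cmod (g x))\<^sup>2)"
        by simp
    qed
  qed measurable
  then show ?thesis by (simp add: L2_def)
qed

lemma L2_linear_combination:
  assumes "finite I" "\<And>i. i \<in> I \<Longrightarrow> \<phi> i \<in> L2 M"
  shows "(\<lambda>x. \<Sum>i\<in>I. c i * \<phi> i x) \<in> L2 M"
  using assms
proof (induction I rule: finite_induct)
  case empty
  then show ?case by (simp add: L2_def)
next
  case (insert i I)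
  have "(\<lambda>x. c i * \<phi> i x) \<in> L2 M"
    using insert.prems[of i] by (auto simp: L2_def norm_mult power_mult_distrib)
  then have "(\<lambda>x. c i * \<phi> i x + (\<Sum>i\<in>I. c i * \<phi> i x)) \<in> L2 M"
    using insert by (intro L2_add) auto
  then show ?case using insert.hyps by simp
qed

lemma L2_inner_linear_combination:
  assumes "\<And>i. i \<in> I \<Longrightarrow> \<phi> i \<in> L2 M" "g \<in> L2 M"
  shows "L2_inner M (\<lambda>x. \<Sum>i\<in>I. c i * \<phi> i x) g = (\<Sum>i\<in>I. c i * L2_inner M (\<phi> i) g)"
proof -
  have "L2_inner M (\<lambda>x. \<Sum>i\<in>I. c i * \<phi> i x) g = (\<integral>x. (\<Sum>i\<in>I. c i * (\<phi> i x * cnj (g x))) \<partial>M)"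
    by (simp add: L2_inner_def sum_distrib_right mult.assoc)
  also have "\<dots> = (\<Sum>i\<in>I. c i * L2_inner M (\<phi> i) g)"
    using assms by (subst Bochner_Integration.integral_sum) (auto simp: L2_inner_def intro!: L2_inner_integrable)
  finally show ?thesis .
qed

lemma L2_inner_commute: "L2_inner M g f = cnj (L2_inner M f g)"
  unfolding L2_inner_def by (subst Bochner_Integration.integral_cnj[symmetric]) (simp add: mult.commute)

lemma L2_norm_power2: "(L2_norm M f)\<^sup>2 = (\<integral>x. (cmod (f x))\<^sup>2 \<partial>M)"
  by (simp add: L2_norm_def)

lemma L2_inner_self: "L2_inner M f f = of_real ((L2_norm M f)\<^sup>2)"
  by (simp add: L2_norm_power2 L2_inner_def complex_norm_square[symmetric] flip: of_real_power)

lemma L2_inner_basis_combination: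
  assumes "orthonormal_basis_L2 M \<phi>" "1 \<le> l"
  shows "L2_inner M (\<lambda>x. \<Sum>k=1..N. c k * \<phi> k x) (\<phi> l) = (if l \<le> N then c l else 0)"
proof -
  have "L2_inner M (\<lambda>x. \<Sum>k=1..N. c k * \<phi> k x) (\<phi> l) = (\<Sum>k=1..N. c k * L2_inner M (\<phi> k) (\<phi> l))"
    using assms by (intro L2_inner_linear_combination) (auto simp: orthonormal_basis_L2_def)
  also have "\<dots> = (\<Sum>k=1..N. if k = l then c k else 0)"
    using assms by (intro sum.cong) (auto simp: orthonormal_basis_L2_def)
  finally show ?thesis
    using assms(2) by simp
qed

lemma L2_norm_basis_combination:
  assumes "orthonormal_basis_L2 M \<phi>"
  shows "(L2_norm M (\<lambda>x. \<Sum>k=1..N. c k * \<phi> k x))\<^sup>2 = (\<Sum>k=1..N. (cmod (c k))\<^sup>2)"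
proof -
  let ?f = "\<lambda>x. \<Sum>k=1..N. c k * \<phi> k x"
  have \<phi>: "\<phi> k \<in> L2 M" if "k \<in> {1..N}" for k
    using assms that by (auto simp: orthonormal_basis_L2_def)
  have "of_real ((L2_norm M ?f)\<^sup>2) = L2_inner M ?f ?f"
    by (rule L2_inner_self[symmetric])
  also have "\<dots> = (\<Sum>k=1..N. c k * L2_inner M (\<phi> k) ?f)"
    using \<phi> by (intro L2_inner_linear_combination L2_linear_combination) auto
  also have "\<dots> = (\<Sum>k=1..N. c k * cnj (c k))"
  proof (intro sum.cong refl)
    fix k assume "k \<in> {1..N}"
    then have "L2_inner M ?f (\<phi> k) = c k"
      using L2_inner_basis_combination[OF assms, of k c N] by simp
    then show "c k * L2_inner M (\<phi> k) ?f = c k * cnj (c k)"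
      by (subst L2_inner_commute) simp
  qed
  also have "\<dots> = of_real (\<Sum>k=1..N. (cmod (c k))\<^sup>2)"
    by (simp only: of_real_sum complex_norm_square)
  finally show ?thesis
    by (simp only: of_real_eq_iff)
qed

text \<open>By orthonormality the coefficients beyond \<open>N\<close> vanish, and the series
  reduces to a finite sum.\<close>

lemma sobolev_basis_combination:
  fixes \<phi> :: "nat \<Rightarrow> real^'n \<Rightarrow> complex"
  assumes "orthonormal_basis_L2 sphere_measure \<phi>"
  defines "f \<equiv> \<lambda>c N x. \<Sum>k=1..N. c k * \<phi> k x"
  shows "f c N \<in> sobolev_sphere \<phi> s"
    and "sobolev_norm \<phi> s (f c N) =
      sqrt (\<Sum>l=1..N. real l powr (2 * s / (real CARD('n) - 1)) * (cmod (c l))\<^sup>2)"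
proof -
  let ?w = "\<lambda>l::nat. real l powr (2 * s / (real CARD('n) - 1))"
  let ?a = "\<lambda>l. ?w l * (cmod (L2_inner sphere_measure (f c N) (\<phi> l)))\<^sup>2"
  have inner: "L2_inner sphere_measure (f c N) (\<phi> l) = (if l \<le> N then c l else 0)" if "1 \<le> l" for l
    unfolding f_def using assms(1) that by (rule L2_inner_basis_combination)
  have "?a summable_on {1..} \<longleftrightarrow> (\<lambda>l. ?w l * (cmod (c l))\<^sup>2) summable_on {1..N}"
    by (intro summable_on_cong_neutral) (auto simp: inner)
  moreover have "f c N \<in> L2 sphere_measure"
    using assms(1) unfolding f_def by (intro L2_linear_combination) (auto simp: orthonormal_basis_L2_def)
  ultimately show "f c N \<in> sobolev_sphere \<phi> s"
    by (simp add: sobolev_sphere_def)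
  have "infsum ?a {1..} = infsum (\<lambda>l. ?w l * (cmod (c l))\<^sup>2) {1..N}"
    by (intro infsum_cong_neutral) (auto simp: inner)
  then show "sobolev_norm \<phi> s (f c N) = sqrt (\<Sum>l=1..N. ?w l * (cmod (c l))\<^sup>2)"
    by (simp add: sobolev_norm_def)
qed

subsection \<open>Test functions and the lower bounds\<close>

text \<open>For \<open>s = 1\<close> the left side is the weight of index \<open>l\<close> in the
  squared Sobolev norm. As \<open>l \<le> 3 m ^ (n - 1)\<close>, the root of order
  \<open>n - 1\<close> makes it quadratic in \<open>m\<close>.\<close>

lemma powr_index_le:
  assumes "2 \<le> n" "1 \<le> m" "l \<le> 2 * m ^ (n - 1) + 1"
  shows "real l powr (2 / (real n - 1)) \<le> (3 * real m)\<^sup>2"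
proof -
  let ?r = "real n - 1"
  have r: "1 \<le> ?r" using assms by simp
  have "real l \<le> real (3 * m ^ (n - 1))"
  proof -
    have "1 \<le> m ^ (n - 1)" using assms by simp
    then show ?thesis using assms(3) unfolding of_nat_le_iff by linarith
  qed
  then have "real l powr (2 / ?r) \<le> (3 * real m ^ (n - 1)) powr (2 / ?r)"
    using r by (intro powr_mono2) auto
  also have "\<dots> = 3 powr (2 / ?r) * (real m ^ (n - 1)) powr (2 / ?r)"
    by (simp add: powr_mult)
  also have "(real m ^ (n - 1)) powr (2 / ?r) = (real m powr ?r) powr (2 / ?r)"
    using assms by (simp add: powr_realpow[symmetric] of_nat_diff)
  also have "\<dots> = real m powr 2"
  proof -
    have "y * (2 / y) = 2" if "1 \<le> y" for y :: real
      using that by simp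
    from this[OF r] have "?r * (2 / ?r) = 2" .
    then show ?thesis by (simp only: powr_powr)
  qed
  \<comment> \<open>The hypothesis \<open>n \<ge> 2\<close> gives
    \<open>2 / (n - 1) \<le> 2\<close>, so the constant 3 is at most squared.\<close>
  also have "3 powr (2 / ?r) * real m powr 2 \<le> 3 powr 2 * real m powr 2"
    using r by (intro mult_right_mono powr_mono) (auto simp: field_simps)
  also have "\<dots> = (3 * real m)\<^sup>2"
    using assms by (simp add: power_mult_distrib)
  finally show ?thesis .
qed

lemma scaled_herglotz_L2_norm_le:
  fixes f :: "real^'n \<Rightarrow> complex"
  assumes "\<And>x. x \<in> ball 0 1 \<Longrightarrow> cmod (herglotz \<kappa> f x) \<le> B" "0 \<le> B"
  shows "L2_norm (lebesgue_on (ball 0 1)) (scaled_herglotz \<kappa> f)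
    \<le> \<kappa> powr ((real CARD('n) - 1) / 2) * B * sqrt (measure lebesgue (ball (0::real^'n) 1))"
proof -
  let ?b = "\<kappa> powr ((real CARD('n) - 1) / 2) * B"
  let ?M = "lebesgue_on (ball (0::real^'n) 1)"
  have le: "cmod (scaled_herglotz \<kappa> f x) \<le> ?b" if "x \<in> space ?M" for x
    using assms that by (auto simp: scaled_herglotz_def norm_mult space_restrict_space intro!: mult_left_mono)
  interpret finite_measure ?M
    by (intro finite_measure_lebesgue_on) simp
  have "(\<integral>x. (cmod (scaled_herglotz \<kappa> f x))\<^sup>2 \<partial>?M) \<le> (\<integral>x. ?b\<^sup>2 \<partial>?M)"
    by (rule integral_mono') (use le in \<open>auto intro!: power_mono\<close>)
  also have "\<dots> = ?b\<^sup>2 * measure lebesgue (ball (0::real^'n) 1)"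
    by (simp add: measure_restrict_space space_restrict_space)
  finally have "L2_norm ?M (scaled_herglotz \<kappa> f) \<le> sqrt (?b\<^sup>2 * measure lebesgue (ball (0::real^'n) 1))"
    unfolding L2_norm_def by (rule real_sqrt_le_mono)
  then show ?thesis
    using assms(2) by (simp add: real_sqrt_mult)
qed

text \<open>A substitute for Stirling's formula: \<open>(e \<kappa>) ^ m / m!\<close> is a single
  term of the series of \<open>exp (e \<kappa>)\<close>, and \<open>e \<le> 3\<close>.\<close>

lemma power_over_fact_le_exp:
  assumes "0 \<le> (\<kappa>::real)"
  shows "\<kappa> ^ m / fact m \<le> exp (3 * \<kappa> - real m)"
proof -
  have e: "exp 1 * \<kappa> \<le> 3 * \<kappa>"
    using exp_le assms by (intro mult_right_mono) auto
  have "(exp 1 * \<kappa>) ^ m / fact m = (\<Sum>k\<in>{m}. (exp 1 * \<kappa>) ^ k /\<^sub>R fact k)"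
    by (simp add: field_simps)
  also have "\<dots> \<le> (\<Sum>k. (exp 1 * \<kappa>) ^ k /\<^sub>R fact k)"
    using assms by (intro sum_le_suminf summable_exp_generic) auto
  also have "\<dots> = exp (exp 1 * \<kappa>)"
    by (simp add: exp_def)
  also have "\<dots> \<le> exp (3 * \<kappa>)"
    using e by simp
  finally have "exp (real m) * (\<kappa> ^ m / fact m) \<le> exp (3 * \<kappa>)"
    by (simp add: power_mult_distrib exp_of_nat_mult[symmetric])
  then show ?thesis
    by (simp add: exp_diff field_simps)
qed

text \<open>A dimension count yields a unit-scale test function orthogonal to all polynomials of
  degree below \<open>m\<close>. It depends on \<open>m\<close> alone, so one \<open>f\<close>
  serves every \<kappa>; \<open>D\<close> collects the constants from the sphere and the
  ball.\<close>

lemma exists_small_herglotz: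
  fixes \<phi> :: "nat \<Rightarrow> real^'n \<Rightarrow> complex"
  assumes n: "CARD('n) \<ge> 2" and \<phi>: "orthonormal_basis_L2 sphere_measure \<phi>" and m: "1 \<le> m"
  defines "D \<equiv> (measure (sphere_measure :: (real^'n) measure) (sphere 0 1) + 1) * sqrt (measure lebesgue (ball (0::real^'n) 1))"
  shows "\<exists>f \<in> sobolev_sphere \<phi> 1. sobolev_norm \<phi> 1 f \<le> 1 \<and> L2_norm sphere_measure f = 1 / (3 * real m) \<and>
    (\<forall>\<kappa>\<ge>0. L2_norm (lebesgue_on (ball 0 1)) (scaled_herglotz \<kappa> f)
       \<le> \<kappa> powr ((real CARD('n) - 1) / 2) * (\<kappa> ^ m / fact m) * D)"
proof -
  let ?S = "sphere_measure :: (real^'n) measure"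
  \<comment> \<open>Any coordinate may be the one whose exponent is reduced.\<close>
  obtain i :: 'n where True by blast
  define J where "J = {\<alpha> :: 'n \<Rightarrow> nat. \<alpha> i \<le> 1 \<and> (\<forall>j. \<alpha> j < m)}"
  \<comment> \<open>One more than the bound on the number of orthogonality conditions.\<close>
  define N where "N = 2 * m ^ (CARD('n) - 1) + 1"
  have J: "finite J" "card J < card {1..N}"
    using card_reduced_exponents[OF m, of i] by (auto simp: J_def N_def)
  have \<phi>L2: "\<phi> l \<in> L2 ?S" if "l \<in> {1..N}" for l
    using \<phi> that by (auto simp: orthonormal_basis_L2_def)
  have \<phi>int: "integrable ?S (\<phi> l)" if "l \<in> {1..N}" for l
    using \<phi>L2[OF that] by (intro L2_integrable finite_measure_sphere_measure)
  from exists_nontrivial_solution[OF J(1) _ J(2), of "\<lambda>l \<alpha>. \<integral>p. of_real (monomial \<alpha> p) * \<phi> l p \<partial>?S"]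
  obtain b where b: "\<exists>l\<in>{1..N}. b l \<noteq> 0"
    "\<And>\<alpha>. \<alpha> \<in> J \<Longrightarrow> (\<Sum>l=1..N. b l * (\<integral>p. of_real (monomial \<alpha> p) * \<phi> l p \<partial>?S)) = 0"
    by auto
  define s where "s = sqrt (\<Sum>l=1..N. (cmod (b l))\<^sup>2)"
  have "0 < (\<Sum>l=1..N. (cmod (b l))\<^sup>2)"
  proof -
    obtain l where "l \<in> {1..N}" "b l \<noteq> 0" using b(1) by blast
    then show ?thesis by (intro sum_pos2[of _ l]) auto
  qed
  then have s: "0 < s" "s\<^sup>2 = (\<Sum>l=1..N. (cmod (b l))\<^sup>2)"
    by (auto simp: s_def)
  \<comment> \<open>The vector \<open>b\<close> has Euclidean norm \<open>s\<close>. Dividing by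
    \<open>3 m s\<close> gives \<open>L^2\<close> norm \<open>1 / (3 m)\<close>, which the largest
    possible Sobolev weight raises to at most 1.\<close>
  define c where "c l = b l / of_real (3 * real m * s)" for l
  define f where "f p = (\<Sum>l=1..N. c l * \<phi> l p)" for p
  have sumc: "(\<Sum>l=1..N. (cmod (c l))\<^sup>2) = (1 / (3 * real m))\<^sup>2"
  proof -
    have "(\<Sum>l=1..N. (cmod (c l))\<^sup>2) = (\<Sum>l=1..N. (cmod (b l))\<^sup>2) / (3 * real m * s)\<^sup>2"
      by (simp add: c_def norm_divide norm_mult power_divide power_mult_distrib sum_divide_distrib)
    also have "\<dots> = (1 / (3 * real m))\<^sup>2"
      unfolding s(2)[symmetric] using s(1) m by (simp add: power_divide power_mult_distrib)
    finally show ?thesis .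
  qed
  have fL2: "f \<in> L2 ?S"
    unfolding f_def[abs_def] using \<phi>L2 by (intro L2_linear_combination) auto
  then have fint: "integrable ?S f"
    by (intro L2_integrable finite_measure_sphere_measure)
  have norm2: "(L2_norm ?S f)\<^sup>2 = (1 / (3 * real m))\<^sup>2"
    using L2_norm_basis_combination[OF \<phi>, of c N] unfolding f_def[abs_def] sumc by simp
  then have norm: "L2_norm ?S f = 1 / (3 * real m)"
    by (subst (asm) power2_eq_iff_nonneg) (auto simp: L2_norm_def)
  have "sobolev_norm \<phi> 1 f = sqrt (\<Sum>l=1..N. real l powr (2 * 1 / (real CARD('n) - 1)) * (cmod (c l))\<^sup>2)"
    unfolding f_def[abs_def] by (rule sobolev_basis_combination(2)[OF \<phi>])
  also have "\<dots> \<le> sqrt (\<Sum>l=1..N. (3 * real m)\<^sup>2 * (cmod (c l))\<^sup>2)"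
    using powr_index_le[OF n m] by (intro real_sqrt_le_mono sum_mono mult_right_mono) (auto simp: N_def)
  also have "\<dots> = sqrt ((3 * real m)\<^sup>2 * (1 / (3 * real m))\<^sup>2)"
    by (simp only: sumc flip: sum_distrib_left)
  also have "\<dots> = 1"
    using m by (simp add: power_divide)
  finally have sob: "sobolev_norm \<phi> 1 f \<le> 1" .
  have orthJ: "(\<integral>p. of_real (monomial \<alpha> p) * f p \<partial>?S) = 0" if "\<alpha> \<in> J" for \<alpha>
  proof -
    have int: "integrable ?S (\<lambda>p. of_real (monomial \<alpha> p) * \<phi> l p)" if "l \<in> {1..N}" for l
      by (intro integrable_continuous_mult_sphere \<phi>int that continuous_intros)
    have "(\<integral>p. of_real (monomial \<alpha> p) * f p \<partial>?S) =
        (\<integral>p. (\<Sum>l=1..N. c l * (of_real (monomial \<alpha> p) * \<phi> l p)) \<partial>?S)"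
      by (simp add: f_def sum_distrib_left mult_ac)
    also have "\<dots> = (\<Sum>l=1..N. c l * (\<integral>p. of_real (monomial \<alpha> p) * \<phi> l p \<partial>?S))"
      using int by (subst Bochner_Integration.integral_sum) auto
    also have "\<dots> = (\<Sum>l=1..N. b l * (\<integral>p. of_real (monomial \<alpha> p) * \<phi> l p \<partial>?S)) / of_real (3 * real m * s)"
      by (simp add: c_def sum_divide_distrib)
    finally show ?thesis
      using b(2)[OF that] by simp
  qed
  have orth: "(\<integral>p. of_real (monomial \<alpha> p) * f p \<partial>?S) = 0" if "sum \<alpha> UNIV \<le> m - 1" for \<alpha>
  proof (rule monomial_orthogonal_reduce[OF fint _ that])
    fix \<alpha> :: "'n \<Rightarrow> nat" assume "\<alpha> i \<le> 1" "\<forall>j. \<alpha> j \<le> m - 1"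
    moreover have "k < m \<longleftrightarrow> k \<le> m - 1" for k
      using m by linarith
    ultimately show "(\<integral>p. of_real (monomial \<alpha> p) * f p \<partial>?S) = 0"
      by (intro orthJ) (simp add: J_def)
  qed
  have orth_inner: "(\<integral>p. of_real ((p \<bullet> x) ^ k) * f p \<partial>?S) = 0" if "k \<le> m - 1" for k x
    using inner_power_orthogonal[OF fint orth, of "m - 1" k "\<lambda>_. 0" x] that by (simp add: monomial_def)
  \<comment> \<open>The domination \<open>|f| \<le> 1 + |f|^2\<close> gives a bound independent of
    \<open>m\<close>, because the \<open>L^2\<close> norm of \<open>f\<close> is at most 1.\<close>
  have L1: "(\<integral>p. cmod (f p) \<partial>?S) \<le> measure ?S (sphere 0 1) + 1"
  proof -
    have "(\<integral>p. cmod (f p) \<partial>?S) \<le> (\<integral>p. 1 + (cmod (f p))\<^sup>2 \<partial>?S)"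
    proof (rule integral_mono)
      show "cmod (f p) \<le> 1 + (cmod (f p))\<^sup>2" for p
      proof -
        have "0 \<le> (1 - cmod (f p))\<^sup>2 + cmod (f p)" by simp
        then show ?thesis by (simp add: power2_eq_square algebra_simps)
      qed
    qed (use fint fL2 in \<open>auto simp: L2_def\<close>)
    also have "\<dots> = measure ?S (sphere 0 1) + (1 / (3 * real m))\<^sup>2"
      using fL2 norm2 by (simp add: L2_def L2_norm_power2)
    also have "(1 / (3 * real m))\<^sup>2 \<le> 1"
      using m by (intro power_le_one) (auto simp: field_simps)
    finally show ?thesis by simp
  qed
  have "L2_norm (lebesgue_on (ball 0 1)) (scaled_herglotz \<kappa> f)
       \<le> \<kappa> powr ((real CARD('n) - 1) / 2) * (\<kappa> ^ m / fact m) * D" if \<kappa>: "0 \<le> \<kappa>" for \<kappa>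
  proof -
    have "cmod (herglotz \<kappa> f x) \<le> \<kappa> ^ m / fact m * (measure ?S (sphere 0 1) + 1)" if "x \<in> ball 0 1" for x
    proof -
      \<comment> \<open>Orthogonality up to degree \<open>m - 1\<close> leaves a remainder of order
        \<open>m\<close>.\<close>
      have "cmod (herglotz \<kappa> f x) \<le> \<kappa> ^ Suc (m - 1) / fact (Suc (m - 1)) * (\<integral>p. cmod (f p) \<partial>?S)"
        using that \<kappa> by (intro herglotz_le_if_orthogonal fint orth_inner) auto
      also have "\<dots> \<le> \<kappa> ^ Suc (m - 1) / fact (Suc (m - 1)) * (measure ?S (sphere 0 1) + 1)"
        using L1 \<kappa> by (intro mult_left_mono) auto
      finally show ?thesis using m by simp
    qed
    from scaled_herglotz_L2_norm_le[OF this] \<kappa> show ?thesis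
      by (simp add: D_def mult_ac)
  qed
  moreover have "f \<in> sobolev_sphere \<phi> 1"
    unfolding f_def[abs_def] by (rule sobolev_basis_combination(1)[OF \<phi>])
  ultimately show ?thesis
    using sob norm by blast
qed

theorem theorem1p2:
  fixes \<phi> :: "nat \<Rightarrow> real ^ 'n \<Rightarrow> complex" and \<mu> :: "nat \<Rightarrow> real"
  assumes "CARD('n) \<ge> 2"
    and "laplace_eigenbasis \<phi> \<mu>"
  shows "\<exists>c>0. \<exists>c\<^sub>0>0. \<forall>\<kappa>\<ge>1. \<forall>\<omega> :: real \<Rightarrow> real.
    (\<forall>t\<ge>0. \<omega> t \<ge> 0) \<longrightarrow> mono_on {0..} \<omega> \<longrightarrow>
    (\<forall>f \<in> sobolev_sphere \<phi> 1. sobolev_norm \<phi> 1 f \<le> 1 \<longrightarrow>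
       L2_norm sphere_measure f \<le> \<omega> (L2_norm (lebesgue_on (ball 0 1)) (scaled_herglotz \<kappa> f))) \<longrightarrow>
    (\<forall>t. 0 < t \<and> t \<le> c\<^sub>0 \<longrightarrow>
       \<omega> t \<ge> c * max t (inverse \<kappa> * inverse (1 + ln (1 / t))))"
proof -
  let ?S = "sphere_measure :: (real^'n) measure"
  have \<phi>: "orthonormal_basis_L2 ?S \<phi>"
    using assms(2) by (simp add: laplace_eigenbasis_def)
  obtain C0 where C0: "0 < C0" "\<And>\<kappa> f. 1 \<le> \<kappa> \<Longrightarrow> f \<in> L2 ?S \<Longrightarrow>
      L2_norm (lebesgue_on (ball 0 1)) (scaled_herglotz \<kappa> f) \<le> C0 * L2_norm ?S f"
    using scaled_herglotz_bounded by blast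
  \<comment> \<open>Keeping \<open>C \<ge> 1\<close> ensures \<open>t / C \<le> 1\<close>, so that
    the multiple of \<open>\<phi> 1\<close> used below is admissible.\<close>
  define C where "C = max 1 C0"
  have C: "1 \<le> C" "C0 \<le> C" by (auto simp: C_def)
  define D where "D = (measure ?S (sphere 0 1) + 1) * sqrt (measure lebesgue (ball (0::real^'n) 1))"
  \<comment> \<open>Moves the factor \<open>D\<close> into the exponent; the absolute value keeps
    \<open>K\<close> nonnegative.\<close>
  define K where "K = \<bar>ln (D + 1)\<bar>"
  have D: "0 \<le> D" by (simp add: D_def)
  have DK: "D \<le> exp K"
  proof -
    have "D \<le> exp (ln (D + 1))" using D by simp
    also have "\<dots> \<le> exp K" by (simp add: K_def)
    finally show ?thesis .
  qed
  define n where "n = real CARD('n)"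
  \<comment> \<open>The sum of \<open>3 + n\<close>, \<open>K\<close> and 2, which come from the
    terms in \<kappa>, the constant, and \<open>L + 1\<close> in the upper bound for
    \<open>m\<close> below.\<close>
  define E where "E = 5 + n + K"
  have E: "5 \<le> E" by (simp add: E_def n_def K_def)
  define c where "c = min (1 / C) (1 / (3 * E))"
  have "0 < c" using C(1) E by (simp add: c_def)
  moreover have "\<omega> t \<ge> c * max t (inverse \<kappa> * inverse (1 + ln (1 / t)))"
    if \<kappa>: "1 \<le> \<kappa>" and \<omega>: "mono_on {0..} \<omega>" and
      bound: "\<And>f. f \<in> sobolev_sphere \<phi> 1 \<Longrightarrow> sobolev_norm \<phi> 1 f \<le> 1 \<Longrightarrow>
       L2_norm ?S f \<le> \<omega> (L2_norm (lebesgue_on (ball 0 1)) (scaled_herglotz \<kappa> f))"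
      and t: "0 < t" "t \<le> 1"
    for \<kappa> t :: real and \<omega> :: "real \<Rightarrow> real"
  proof -
    \<comment> \<open>Monotonicity of \<omega> turns every admissible function with image of norm at
      most \<open>t\<close> into a lower bound for \<open>\<omega> t\<close>.\<close>
    have test: "L2_norm ?S f \<le> \<omega> t"
      if "f \<in> sobolev_sphere \<phi> 1" "sobolev_norm \<phi> 1 f \<le> 1"
        "L2_norm (lebesgue_on (ball 0 1)) (scaled_herglotz \<kappa> f) \<le> t" for f
      using bound[OF that(1,2)] mono_onD[OF \<omega> _ _ that(3)] t by (auto simp: L2_norm_def)

    \<comment> \<open>The linear lower bound\<close>
    have linear: "t / C \<le> \<omega> t"
    proof -
      \<comment> \<open>Index 1 has Sobolev weight 1, so both norms of this function equal
        \<open>t / C\<close>.\<close>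
      let ?f = "\<lambda>x. \<Sum>k=1..1. of_real (t / C) * \<phi> k x"
      have norm: "L2_norm ?S ?f = t / C"
      proof (rule power2_eq_imp_eq)
        show "(L2_norm ?S ?f)\<^sup>2 = (t / C)\<^sup>2"
          unfolding L2_norm_basis_combination[OF \<phi>] by (simp add: norm_divide power_divide)
      qed (use C(1) t in \<open>auto simp: L2_norm_def\<close>)
      have "sobolev_norm \<phi> 1 ?f = t / C"
        using sobolev_basis_combination(2)[OF \<phi>, of 1 "\<lambda>_. of_real (t / C)" 1] C(1) t
        by (simp add: norm_divide)
      moreover have "t / C \<le> 1" using C(1) t by (simp add: field_simps)
      moreover have sob: "?f \<in> sobolev_sphere \<phi> 1"
        by (rule sobolev_basis_combination(1)[OF \<phi>])
      moreover have "L2_norm (lebesgue_on (ball 0 1)) (scaled_herglotz \<kappa> ?f) \<le> t"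
      proof -
        have "L2_norm (lebesgue_on (ball 0 1)) (scaled_herglotz \<kappa> ?f) \<le> C0 * (t / C)"
          using C0(2)[OF \<kappa>, of ?f] sob unfolding norm by (simp add: sobolev_sphere_def)
        also have "\<dots> \<le> C * (t / C)"
          using C t by (intro mult_right_mono) auto
        finally show ?thesis using C(1) by simp
      qed
      ultimately show ?thesis
        using test[of ?f] norm by simp
    qed

    \<comment> \<open>The logarithmic lower bound\<close>
    have log: "1 / (3 * E) * (inverse \<kappa> * inverse (1 + ln (1 / t))) \<le> \<omega> t"
    proof -
      define L where "L = ln (1 / t)"
      have L: "0 \<le> L" "exp (- L) = t"
        using t by (simp_all add: L_def ln_div)
      \<comment> \<open>Chosen so that \<open>exp (- m)\<close> beats all factors:
        \<open>n * \<kappa>\<close> pays for the power of \<kappa> in the normalisation,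
        \<open>3 * \<kappa>\<close> for \<open>\<kappa> ^ m / fact m\<close>, \<open>K\<close> for
        \<open>D\<close>, and \<open>L\<close> leaves \<open>exp (- L) = t\<close>.\<close>
      define m where "m = nat \<lceil>(3 + n) * \<kappa> + K + L\<rceil>"
      have nK: "0 \<le> n" "0 \<le> K" by (auto simp: n_def K_def)
      have pos: "3 \<le> (3 + n) * \<kappa> + K + L"
      proof -
        have "3 * 1 \<le> (3 + n) * \<kappa>" using nK \<kappa> by (intro mult_mono) auto
        then show ?thesis using nK L by linarith
      qed
      have m_ge: "(3 + n) * \<kappa> + K + L \<le> real m" and m_le: "real m \<le> (3 + n) * \<kappa> + K + L + 1"
        using pos unfolding m_def by linarith+
      have "1 \<le> m" using m_ge pos by linarith
      from exists_small_herglotz[OF assms(1) \<phi> this] obtain f where f: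
        "f \<in> sobolev_sphere \<phi> 1" "sobolev_norm \<phi> 1 f \<le> 1" "L2_norm ?S f = 1 / (3 * real m)"
        "L2_norm (lebesgue_on (ball 0 1)) (scaled_herglotz \<kappa> f) \<le> \<kappa> powr ((n - 1) / 2) * (\<kappa> ^ m / fact m) * D"
        using \<kappa> by (auto simp: D_def n_def)
      have "\<kappa> powr ((n - 1) / 2) \<le> exp (n * \<kappa>)"
      proof -
        have "\<kappa> powr ((n - 1) / 2) \<le> \<kappa> powr n"
          using \<kappa> nK by (intro powr_mono) auto
        also have "\<dots> = exp (n * ln \<kappa>)"
          using \<kappa> by (simp add: powr_def)
        also have "\<dots> \<le> exp (n * \<kappa>)"
          using \<kappa> nK ln_le_minus_one[of \<kappa>] by (auto intro!: mult_left_mono)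
        finally show ?thesis .
      qed
      then have "\<kappa> powr ((n - 1) / 2) * (\<kappa> ^ m / fact m) * D \<le> exp (n * \<kappa>) * exp (3 * \<kappa> - real m) * exp K"
        using \<kappa> D DK power_over_fact_le_exp[of \<kappa> m] by (intro mult_mono) auto
      also have "\<dots> = exp (n * \<kappa> + (3 * \<kappa> - real m) + K)"
        by (simp add: exp_add)
      also have "\<dots> \<le> exp (- L)"
        using m_ge by (simp add: algebra_simps)
      finally have "1 / (3 * real m) \<le> \<omega> t"
        using test[OF f(1,2)] f(3,4) L(2) by simp
      \<comment> \<open>All terms of \<open>m\<close> are absorbed into one multiple of
        \<open>\<kappa> * (1 + L)\<close>, which dominates 1, \<kappa> and \<open>L\<close>.\<close>
      moreover have "real m \<le> E * (\<kappa> * (1 + L))"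
      proof -
        have le: "1 \<le> \<kappa> * (1 + L)" "\<kappa> \<le> \<kappa> * (1 + L)" "L \<le> \<kappa> * (1 + L)"
          using \<kappa> L mult_mono[of 1 \<kappa> 1 "1 + L"] mult_mono[of 1 \<kappa> L "1 + L"] mult_left_mono[of 1 "1 + L" \<kappa>] by auto
        have "(3 + n) * \<kappa> \<le> (3 + n) * (\<kappa> * (1 + L))"
          using nK by (intro mult_left_mono le) auto
        moreover have "K * 1 \<le> K * (\<kappa> * (1 + L))"
          using nK by (intro mult_left_mono le)
        moreover have "L + 1 \<le> 2 * (\<kappa> * (1 + L))"
          using le by linarith
        ultimately show ?thesis
          using m_le unfolding E_def by (simp add: algebra_simps)
      qed
      then have "1 / (3 * (E * (\<kappa> * (1 + L)))) \<le> 1 / (3 * real m)"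
        using \<open>1 \<le> m\<close> by (intro divide_left_mono mult_pos_pos mult_left_mono) (use \<kappa> L E in auto)
      ultimately show ?thesis
        by (simp add: L_def field_simps)
    qed
    have x: "0 \<le> inverse \<kappa> * inverse (1 + ln (1 / t))"
    proof -
      have "0 \<le> ln (1 / t)" using t by simp
      then show ?thesis using \<kappa> by (intro mult_nonneg_nonneg) auto
    qed
    have "c * t \<le> 1 / C * t" "c * (inverse \<kappa> * inverse (1 + ln (1 / t))) \<le> 1 / (3 * E) * (inverse \<kappa> * inverse (1 + ln (1 / t)))"
      using t x by (intro mult_right_mono; simp add: c_def)+
    with linear log show ?thesis
      by (simp add: max_def)
  qed
  \<comment> \<open>The threshold \<open>c\<^sub>0\<close> is 1: for \<open>t \<le> 1\<close> the
    logarithm of \<open>1 / t\<close> is nonnegative and \<open>t / C\<close> is at most 1.\<close>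
  ultimately show ?thesis
    by (intro exI[of _ c] exI[of _ 1] conjI allI impI) auto
qed

end
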